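(* Let $(X_t)_{t\in\mathbb{R}^N_+}$ be an $N$-parameter Lévy process with values in $\mathbb{R}^d$ and multidimensional Lévy exponent $\Psi=(\psi_1,\dots,\psi_N)$, so that $\mathbb{E}e^{i\xi\cdot X_t}=e^{t\cdot\Psi(\xi)}$ for all $t\in\mathbb{R}^N_+$, $\xi\in\mathbb{R}^d$. Let $T_th(x)=\mathbb{E}\,h(x+X_t)$, $h\in\mathcal{C}_0(\mathbb{R}^d)$, $t\in\mathbb{R}^N_+$, be the associated semigroup and let $G=(G_1,\dots,G_N)$ be its generator. Then: (1) For any $t\in\mathbb{R}^N_+$, $T_t$ is a pseudo-differential operator with symbol $e^{t\cdot\Psi}$, i.e. $$T_th(x)=\frac{1}{(2\pi)^{d/2}}\int_{\mathbb{R}^d}e^{i\xi\cdot x}e^{t\cdot\Psi(\xi)}\hat h(\xi)\,d\xi,\qquad h\in\mathcal{S}(\mathbb{R}^d).$$ (2) $G$ is a pseudo-differential operator with symbol $\Psi$, i.e. for each $i=1,\dots,N$, $$G_ih(x)=\frac{1}{(2\pi)^{d/2}}\int_{\mathbb{R}^d}e^{i\xi\cdot x}\psi_i(\xi)\hat h(\xi)\,d\xi,\qquad h\in\mathcal{S}(\mathbb{R}^d).$$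
   Context: $\mathbb{R}^N_+=[0,\infty)^N$ with the partial order $a\preceq b$ iff $a_j\le b_j$ for all $j$; $\{e_1,\dots,e_N\}$ is the canonical basis of $\mathbb{R}^N$. $\mathcal{C}_0(\mathbb{R}^d)$ is the space of continuous functions vanishing at infinity with the sup-norm; $\mathcal{S}(\mathbb{R}^d)$ is the Schwartz space. Fourier transform: $\hat h(\xi)=(2\pi)^{-d/2}\int_{\mathbb{R}^d}e^{-i\xi\cdot x}h(x)\,dx$. A function on $\mathbb{R}^N_+$ is right continuous at $x$ if $f(x_i)\to f(x)$ for every $\preceq$-decreasing sequence $x_i\to x$; it has left limits at $x\ne0$ if $\lim f(x_i)$ exists for every $\preceq$-increasing sequence $x_i\to x$ (the limit may depend on the sequence); it is cadlag if it is right continuous everywhere and has left limits at every $x\neq 0$. An $N$-parameter (Multiparameter) Lévy process $(X_t)_{t\in\mathbb{R}^N_+}$ with values in $\mathbb{R}^d$ is a random field such that: (1) $X_0=0$ a.s.; (2) for any $0=t^{(0)}\preceq t^{(1)}\preceq\dots\preceq t^{(k)}$ the increments $X_{t^{(j)}}-X_{t^{(j-1)}}$, $j=1,\dots,k$, are independent; (3) $X_{t+\tau}-X_t\overset{d}{=}X_\tau$ for all $t,\tau\in\mathbb{R}^N_+$; (4) its paths are a.s. cadlag; (5) it is continuous in probability. For each $j$, $(X_{t_je_j})_{t_j\ge0}$ is a one-parameter Lévy process and $\psi_j$ denotes its Lévy exponent: $\mathbb{E}e^{i\xi\cdot X_{t_je_j}}=e^{t_j\psi_j(\xi)}$. The generator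 of a strongly continuous $N$-parameter semigroup $(T_t)_{t\in\mathbb{R}^N_+}$ (bounded operators with $T_0=I$, $T_{s+t}=T_sT_t$, $T_tu\to u$ as $t\to0$) is the vector $G=(G_1,\dots,G_N)$, where $G_i$ is the generator of the one-parameter marginal semigroup $(T_{t_ie_i})_{t_i\ge0}$, with $Dom(G)=\bigcap_jDom(G_j)$. The semigroup $T_t$ above is a strongly continuous contraction semigroup on $\mathcal{C}_0(\mathbb{R}^d)$. *)

theory Defs
  imports "HOL-Probability.Probability"
begin

text \<open>
  The parameter space is the nonnegative orthant of \<^typ>\<open>real^'n\<close>: the order on vectors is
  componentwise, so it is the set of all \<open>t\<close> with \<open>0 \<le> t\<close>, and \<open>axis j 1\<close> is
  the canonical basis vector \<open>e\<^sub>j\<close>. Functions on the orthant are total functions on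
  \<^typ>\<open>real^'n\<close> that are only ever constrained there.
\<close>

subsection \<open>Multiparameter Levy processes\<close>

definition right_continuous_orthant :: "(real^'n \<Rightarrow> 'b::topological_space) \<Rightarrow> real^'n \<Rightarrow> bool" where
  "right_continuous_orthant f x \<longleftrightarrow>
     (\<forall>s. decseq s \<and> (\<forall>i. 0 \<le> s i) \<and> s \<longlonglongrightarrow> x \<longrightarrow> (\<lambda>i. f (s i)) \<longlonglongrightarrow> f x)"

definition left_limits_orthant :: "(real^'n \<Rightarrow> 'b::topological_space) \<Rightarrow> real^'n \<Rightarrow> bool" where
  "left_limits_orthant f x \<longleftrightarrow>
     (\<forall>s. incseq s \<and> (\<forall>i. 0 \<le> s i) \<and> s \<longlonglongrightarrow> x \<longrightarrow> convergent (\<lambda>i. f (s i)))"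

definition cadlag_orthant :: "(real^'n \<Rightarrow> 'b::topological_space) \<Rightarrow> bool" where
  "cadlag_orthant f \<longleftrightarrow>
     (\<forall>x\<ge>0. right_continuous_orthant f x) \<and> (\<forall>x\<ge>0. x \<noteq> 0 \<longrightarrow> left_limits_orthant f x)"

locale multiparameter_levy_process = prob_space M
  for M :: "'w measure" +
  fixes X :: "real^'n \<Rightarrow> 'w \<Rightarrow> real^'d"
  assumes random_variable_X: "\<And>t. 0 \<le> t \<Longrightarrow> random_variable borel (X t)"
    and starts_at_0: "AE \<omega> in M. X 0 \<omega> = 0"
    and independent_increments:
      "\<And>(t :: nat \<Rightarrow> real^'n) k. t 0 = 0 \<Longrightarrow> (\<And>j. j < k \<Longrightarrow> t j \<le> t (Suc j)) \<Longrightarrow>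
         indep_vars (\<lambda>_. borel) (\<lambda>j \<omega>. X (t (Suc j)) \<omega> - X (t j) \<omega>) {..<k}"
    and stationary_increments:
      "\<And>t \<tau>. 0 \<le> t \<Longrightarrow> 0 \<le> \<tau> \<Longrightarrow>
         distr M borel (\<lambda>\<omega>. X (t + \<tau>) \<omega> - X t \<omega>) = distr M borel (X \<tau>)"
    and cadlag_paths: "AE \<omega> in M. cadlag_orthant (\<lambda>t. X t \<omega>)"
    and continuous_in_probability:
      "\<And>t \<epsilon>. 0 \<le> t \<Longrightarrow> 0 < \<epsilon> \<Longrightarrow>
         ((\<lambda>s. prob {\<omega> \<in> space M. \<epsilon> < norm (X s \<omega> - X t \<omega>)}) \<longlongrightarrow> 0) (at t within {0..})"

text \<open>
  The \<open>j\<close>-th component is the Levy exponent of the one-parameter process running along the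
  \<open>j\<close>-th axis. It is determined by the process, since \<open>\<Psi> \<xi> $ j\<close> is the derivative
  at \<open>t = 0\<close> of the right-hand side.
\<close>
definition levy_exponent ::
    "'w measure \<Rightarrow> (real^'n \<Rightarrow> 'w \<Rightarrow> real^'d) \<Rightarrow> (real^'d \<Rightarrow> complex^'n) \<Rightarrow> bool" where
  "levy_exponent M X \<Psi> \<longleftrightarrow>
     (\<forall>j \<xi>. \<forall>t\<ge>0. (LINT \<omega>|M. exp (\<i> * of_real (\<xi> \<bullet> X (t *\<^sub>R axis j 1) \<omega>)))
        = exp (of_real t * \<Psi> \<xi> $ j))"

subsection \<open>Continuous functions vanishing at infinity, and generators\<close>

definition C0 :: "(real^'d \<Rightarrow> complex) set" where
  "C0 = {u. continuous_on UNIV u \<and> (u \<longlongrightarrow> 0) at_infinity}"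

definition levy_semigroup ::
    "'w measure \<Rightarrow> (real^'n \<Rightarrow> 'w \<Rightarrow> real^'d) \<Rightarrow> real^'n \<Rightarrow> (real^'d \<Rightarrow> complex) \<Rightarrow> real^'d \<Rightarrow> complex" where
  "levy_semigroup M X t h x = (LINT \<omega>|M. h (x + X t \<omega>))"

text \<open>
  \<open>has_generator S u v\<close>: the function \<open>u\<close> lies in the domain of the generator of the
  one-parameter semigroup \<open>S\<close> on \<^const>\<open>C0\<close>, and the generator maps it to \<open>v\<close>.
  Convergence of the difference quotients in the sup-norm is uniform convergence.
\<close>
definition has_generator ::
    "(real \<Rightarrow> (real^'d \<Rightarrow> complex) \<Rightarrow> real^'d \<Rightarrow> complex) \<Rightarrow>
     (real^'d \<Rightarrow> complex) \<Rightarrow> (real^'d \<Rightarrow> complex) \<Rightarrow> bool" where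
  "has_generator S u v \<longleftrightarrow> u \<in> C0 \<and> v \<in> C0 \<and>
     uniform_limit UNIV (\<lambda>r x. (S r u x - u x) /\<^sub>R r) v (at_right 0)"

lemma has_generator_unique:
  assumes "has_generator S u v" "has_generator S u w"
  shows "v = w"
proof
  fix x
  have "((\<lambda>r. (S r u x - u x) /\<^sub>R r) \<longlongrightarrow> v x) (at_right 0)"
    "((\<lambda>r. (S r u x - u x) /\<^sub>R r) \<longlongrightarrow> w x) (at_right 0)"
    using assms unfolding has_generator_def by (auto intro: tendsto_uniform_limitI)
  then show "v x = w x"
    by (rule tendsto_unique[OF trivial_limit_at_right_real])
qed

definition generator_dom ::
    "(real \<Rightarrow> (real^'d \<Rightarrow> complex) \<Rightarrow> real^'d \<Rightarrow> complex) \<Rightarrow> (real^'d \<Rightarrow> complex) set" where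
  "generator_dom S = {u. \<exists>v. has_generator S u v}"

definition generator ::
    "(real \<Rightarrow> (real^'d \<Rightarrow> complex) \<Rightarrow> real^'d \<Rightarrow> complex) \<Rightarrow>
     (real^'d \<Rightarrow> complex) \<Rightarrow> real^'d \<Rightarrow> complex" where
  "generator S u = (THE v. has_generator S u v)"

definition marginal_semigroup ::
    "(real^'n \<Rightarrow> (real^'d \<Rightarrow> complex) \<Rightarrow> real^'d \<Rightarrow> complex) \<Rightarrow> 'n \<Rightarrow>
     real \<Rightarrow> (real^'d \<Rightarrow> complex) \<Rightarrow> real^'d \<Rightarrow> complex" where
  "marginal_semigroup T i r = T (r *\<^sub>R axis i 1)"

definition multi_generator_dom ::
    "(real^'n \<Rightarrow> (real^'d \<Rightarrow> complex) \<Rightarrow> real^'d \<Rightarrow> complex) \<Rightarrow> (real^'d \<Rightarrow> complex) set" where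
  "multi_generator_dom T = (\<Inter>i. generator_dom (marginal_semigroup T i))"

definition multi_generator ::
    "(real^'n \<Rightarrow> (real^'d \<Rightarrow> complex) \<Rightarrow> real^'d \<Rightarrow> complex) \<Rightarrow> 'n \<Rightarrow>
     (real^'d \<Rightarrow> complex) \<Rightarrow> real^'d \<Rightarrow> complex" where
  "multi_generator T i = generator (marginal_semigroup T i)"

subsection \<open>Schwartz functions and pseudo-differential operators\<close>

definition partial_deriv :: "'d \<Rightarrow> (real^'d \<Rightarrow> complex) \<Rightarrow> real^'d \<Rightarrow> complex" where
  "partial_deriv i h x = frechet_derivative h (at x) (axis i 1)"

text \<open>
  A list of coordinates encodes an iterated partial derivative. A function is smooth iff all its
  iterated partial derivatives (itself included, for the empty list) are everywhere differentiable;
  \<open>\<alpha>\<close> is the exponent of a monomial.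
\<close>
definition schwartz :: "(real^'d \<Rightarrow> complex) set" where
  "schwartz = {h.
     (\<forall>is x. foldr partial_deriv is h differentiable (at x)) \<and>
     (\<forall>is (\<alpha> :: 'd \<Rightarrow> nat).
        bounded (range (\<lambda>x. (\<Prod>j\<in>UNIV. x $ j ^ \<alpha> j) *\<^sub>R foldr partial_deriv is h x)))}"

definition fourier :: "(real^'d \<Rightarrow> complex) \<Rightarrow> real^'d \<Rightarrow> complex" where
  "fourier h \<xi> = of_real ((2 * pi) powr (- real CARD('d) / 2)) *
     (LINT x|lborel. exp (- \<i> * of_real (\<xi> \<bullet> x)) * h x)"

text \<open>
  Integrability is required because the Bochner integral of a non-integrable function is \<open>0\<close>
  by convention.
\<close>
definition pseudo_diff_op ::
    "((real^'d \<Rightarrow> complex) \<Rightarrow> real^'d \<Rightarrow> complex) \<Rightarrow> (real^'d \<Rightarrow> complex) \<Rightarrow> bool" where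
  "pseudo_diff_op A p \<longleftrightarrow> (\<forall>h\<in>schwartz. \<forall>x.
     integrable lborel (\<lambda>\<xi>. exp (\<i> * of_real (\<xi> \<bullet> x)) * p \<xi> * fourier h \<xi>) \<and>
     A h x = of_real ((2 * pi) powr (- real CARD('d) / 2)) *
       (LINT \<xi>|lborel. exp (\<i> * of_real (\<xi> \<bullet> x)) * p \<xi> * fourier h \<xi>))"

end

theory Submission
  imports Defs
begin

text \<open>
  Independence and stationarity of the increments give \<open>E exp (i \<xi> X\<^sub>t) = exp (t \<Psi>(\<xi>))\<close>, so (1) is
  Fourier inversion of \<open>h\<close> under the expectation, with Fubini. For (2), the difference quotient
  of the \<open>j\<close>-th marginal semigroup has symbol \<open>(exp (r \<psi>\<^sub>j) - 1) / r\<close>, which is bounded by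
  \<open>\<bar>\<psi>\<^sub>j\<bar>\<close> because \<open>Re \<psi>\<^sub>j \<le> 0\<close>. Since \<open>\<psi>\<^sub>j\<close> grows polynomially and the transform of a
  Schwartz function decays rapidly, dominated convergence in \<open>\<xi>\<close> gives a limit uniform in \<open>x\<close>.
\<close>

subsection \<open>Lebesgue integration on \<open>real^'d\<close>\<close>

text \<open>The hard point is the growth of the exponent, which is known only through the
  characteristic functions on the axes; it is bounded by direct probabilistic estimates instead of a
  Levy-Khintchine formula. Continuity in probability at time 0 bounds it on the unit ball. The
  inequalities 1 - cos 2a \<le> 4 (1 - cos a) and |sin 2a - 2 sin a| \<le> 2 (1 - cos a), integrated
  against the law of \<open>X\<close> at a small time r, divided by r and taken to the limit r -> 0,
  show that doubling \<xi> multiplies |Re| + |Im| of the exponent by at most 8, hence cubic growth.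

  On the Fourier side, decay is measured by the product over coordinates of 1 + x_j^2. Its
  reciprocal is integrable by a one-dimensional computation, and it expands into the monomials that
  the Schwartz seminorms control. Three powers of it are spent on the symbol of the generator: two
  against the growth of the exponent, one for integrability.\<close>

lemma
  fixes f :: "'d::finite \<Rightarrow> real \<Rightarrow> 'b::{real_normed_field,banach,second_countable_topology}"
  assumes f: "\<And>j. integrable lborel (f j)"
  shows integrable_lborel_vec_prod:
      "integrable lborel (\<lambda>x::real^'d. \<Prod>j\<in>UNIV. f j (x $ j))" (is ?int)
    and integral_lborel_vec_prod:
      "(LINT x|lborel. (\<Prod>j\<in>UNIV. f j ((x::real^'d) $ j))) = (\<Prod>j\<in>UNIV. (LINT y|lborel. f j y))" (is ?eq)
proof -
  interpret product_sigma_finite "\<lambda>b::real^'d. lborel :: real measure"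
    by unfold_locales
  let ?B = "Basis :: (real^'d) set"
  let ?P = "Pi\<^sub>M ?B (\<lambda>_. lborel :: real measure)"
  let ?T = "\<lambda>g. \<Sum>b\<in>?B. g b *\<^sub>R b"
  \<comment> \<open>The product theorem is indexed by basis vectors, the family \<open>f\<close> by
    coordinates; \<open>SOME\<close> inverts the injective map from \<open>j\<close> to
    \<open>axis j 1\<close>.\<close>
  define F where "F b = f (SOME j. b = axis j 1)" for b :: "real^'d"
  have F_axis: "F (axis j 1) = f j" for j
  proof -
    have "(SOME k. axis j 1 = (axis k 1 :: real^'d)) = j"
      by (rule some_equality) (auto simp: axis_eq_axis)
    then show ?thesis by (simp add: F_def)
  qed
  have Basis_eq: "?B = (\<lambda>j. axis j 1) ` UNIV"
    by (auto simp: Basis_vec_def)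
  have inj: "inj (\<lambda>j::'d. axis j (1::real))"
    by (auto simp: inj_def axis_eq_axis)
  have F: "integrable lborel (F b)" if "b \<in> ?B" for b
    using that f by (auto simp: Basis_eq F_axis)
  have [measurable]: "f j \<in> borel_measurable borel" for j
    using f[of j] by (auto dest: borel_measurable_integrable)
  have comp: "?T g $ j = g (axis j 1)" for g j
    unfolding cart_eq_inner_axis by (rule inner_sum_left_Basis) (simp add: Basis_eq)
  have prod_eq: "(\<Prod>j\<in>UNIV. f j (?T g $ j)) = (\<Prod>b\<in>?B. F b (g b))" for g
    by (simp only: comp) (simp add: Basis_eq prod.reindex[OF inj] F_axis)
  have T: "?T \<in> ?P \<rightarrow>\<^sub>M borel"
    by measurable
  have meas: "(\<lambda>x::real^'d. \<Prod>j\<in>UNIV. f j (x $ j)) \<in> borel_measurable borel"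
    by measurable
  have "integrable ?P (\<lambda>g. \<Prod>b\<in>?B. F b (g b))"
    by (rule product_integrable_prod) (auto simp: F)
  then show ?int
    by (subst lborel_eq, subst integrable_distr_eq[OF T meas]) (simp only: prod_eq)
  have "(LINT x|lborel. (\<Prod>j\<in>UNIV. f j ((x::real^'d) $ j))) = (LINT g|?P. (\<Prod>b\<in>?B. F b (g b)))"
    by (subst lborel_eq, subst integral_distr[OF T meas]) (simp only: prod_eq)
  also have "\<dots> = (\<Prod>b\<in>?B. (LINT y|lborel. F b y))"
    by (rule product_integral_prod) (auto simp: F)
  also have "\<dots> = (\<Prod>j\<in>UNIV. (LINT y|lborel. f j y))"
    by (simp add: Basis_eq prod.reindex[OF inj] F_axis)
  finally show ?eq .
qed

text \<open>Used with \<open>c = 1\<close> as translation invariance and with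
  \<open>c = \<epsilon>\<close> to rescale Gaussians; the power of |c| is the Jacobian.\<close>

lemma
  fixes f :: "'a::euclidean_space \<Rightarrow> 'b::{banach,second_countable_topology}"
  assumes c: "c \<noteq> 0" and [measurable]: "f \<in> borel_measurable borel"
  shows integrable_lborel_affine:
      "integrable lborel f \<Longrightarrow> integrable lborel (\<lambda>x. f (t + c *\<^sub>R x))"
    and integral_lborel_affine:
      "(LINT x|lborel. f x) = \<bar>c\<bar> ^ DIM('a) *\<^sub>R (LINT x|lborel. f (t + c *\<^sub>R x))"
proof -
  show "(LINT x|lborel. f x) = \<bar>c\<bar> ^ DIM('a) *\<^sub>R (LINT x|lborel. f (t + c *\<^sub>R x))"
    by (subst lborel_affine[OF c, of t], subst integral_density)
      (simp_all add: integral_distr)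
  assume "integrable lborel f"
  then have "integrable (density (distr lborel borel (\<lambda>x. t + c *\<^sub>R x)) (\<lambda>_. ennreal (\<bar>c\<bar> ^ DIM('a)))) f"
    using lborel_affine[OF c, of t] by (simp add: ennreal_power)
  \<comment> \<open>Removing the density leaves the Jacobian as a constant factor of the integrand;
    it is nonzero and is divided out.\<close>
  then show "integrable lborel (\<lambda>x. f (t + c *\<^sub>R x))"
    using c integrable_scaleR_right[where c="inverse (\<bar>c\<bar> ^ DIM('a))"
        and f="\<lambda>x. \<bar>c\<bar> ^ DIM('a) *\<^sub>R f (t + c *\<^sub>R x)" and M=lborel]
    by (simp add: integrable_density integrable_distr_eq)
qed

text \<open>A product rather than a power of 1 + |x|^2: the reciprocal then factors into
  one-dimensional integrable functions, and the weight itself is a sum of monomials.\<close>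

definition vec_weight :: "real^'d \<Rightarrow> real" where
  "vec_weight x = (\<Prod>j\<in>UNIV. 1 + (x $ j)\<^sup>2)"

text \<open>Expanding the product yields 1, every single square, and further nonnegative
  terms.\<close>

lemma one_plus_norm_le_vec_weight: "1 + (norm x)\<^sup>2 \<le> vec_weight x"
proof -
  have *: "1 + (\<Sum>j\<in>S. (x $ j)\<^sup>2) \<le> (\<Prod>j\<in>S. 1 + (x $ j)\<^sup>2)" if "finite S" for S
    using that
  proof induction
    case (insert j S)
    have "1 \<le> (\<Prod>j\<in>S. 1 + (x $ j)\<^sup>2)"
      by (rule prod_ge_1) simp
    then have "(x $ j)\<^sup>2 \<le> (x $ j)\<^sup>2 * (\<Prod>j\<in>S. 1 + (x $ j)\<^sup>2)"
      by (simp add: mult_le_cancel_left1)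
    with insert show ?case by (simp add: algebra_simps)
  qed simp
  have "(norm x)\<^sup>2 = (\<Sum>j\<in>UNIV. (x $ j)\<^sup>2)"
    by (simp add: norm_vec_def L2_set_def sum_nonneg)
  with *[of UNIV] show ?thesis by (simp add: vec_weight_def)
qed

lemma vec_weight_ge_1: "1 \<le> vec_weight x"
  using one_plus_norm_le_vec_weight[of x] by (smt (verit) zero_le_power2)

lemma vec_weight_pos: "0 < vec_weight x"
  using vec_weight_ge_1[of x] by linarith

lemma vec_weight_measurable [measurable]: "vec_weight \<in> borel_measurable borel"
  unfolding vec_weight_def by measurable

lemma integrable_inverse_vec_weight: "integrable lborel (\<lambda>x::real^'d. inverse (vec_weight x))"
proof -
  have "integrable lborel (\<lambda>x::real. inverse (1 + x\<^sup>2))"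
    using integrable_inverse_1_plus_square by (simp add: set_integrable_def)
  from integrable_lborel_vec_prod[where f="\<lambda>_. \<lambda>x. inverse (1 + x\<^sup>2)", OF this]
  show ?thesis
    by (simp add: vec_weight_def prod_inversef[symmetric] comp_def)
qed

lemma integrable_of_weight_bound:
  fixes f :: "real^'d \<Rightarrow> 'b::{banach,second_countable_topology}"
  assumes "f \<in> borel_measurable borel" "\<And>x. norm (f x) * vec_weight x \<le> C"
  shows "integrable lborel f"
proof (rule Bochner_Integration.integrable_bound)
  show "integrable lborel (\<lambda>x. C * inverse (vec_weight x))"
    by (intro integrable_mult_right integrable_inverse_vec_weight)
  have "norm (f x) \<le> norm (C * inverse (vec_weight x))" for x
    using assms(2)[of x] vec_weight_pos[of x] by (simp add: field_simps)
  then show "AE x in lborel. norm (f x) \<le> norm (C * inverse (vec_weight x))" by simp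
qed (use assms in simp)

text \<open>Trades the weight at a shifted point for the weight at \<open>x\<close>, so that one
  integrable majorant serves all difference quotients with step at most 1. The factor 3 is paid in
  every coordinate, although only the \<open>j\<close>-th one moves.\<close>

lemma vec_weight_translate:
  assumes "\<bar>r\<bar> \<le> 1"
  shows "vec_weight (x :: real^'d) \<le> 3 ^ CARD('d) * vec_weight (x + r *\<^sub>R axis j 1)"
proof -
  have le: "1 + a\<^sup>2 \<le> 3 * (1 + (a + b)\<^sup>2)" if "\<bar>b\<bar> \<le> 1" for a b :: real
  proof -
    have "b\<^sup>2 \<le> 1" using that by (simp add: abs_square_le_1)
    \<comment> \<open>The right side minus the left side is 2 (a + 3b/2)^2 + 2 - (3/2) b^2, which is
      positive when b^2 \<le> 1.\<close>
    moreover have "0 \<le> 2 * (a + 3 / 2 * b)\<^sup>2" by simp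
    ultimately show ?thesis unfolding power2_eq_square by (simp add: algebra_simps)
  qed
  have "vec_weight x \<le> (\<Prod>k\<in>UNIV. 3 * (1 + ((x + r *\<^sub>R axis j 1) $ k)\<^sup>2))"
    unfolding vec_weight_def
  proof (intro prod_mono conjI)
    fix k
    show "1 + (x $ k)\<^sup>2 \<le> 3 * (1 + ((x + r *\<^sub>R axis j 1) $ k)\<^sup>2)"
      using le[of "r * axis j 1 $ k" "x $ k"] assms by (simp add: axis_def split: if_splits)
  qed simp
  then show ?thesis by (simp only: prod.distrib prod_constant vec_weight_def)
qed

subsection \<open>Fourier transforms of Schwartz functions\<close>

lemma tendsto_diff_quotient:
  fixes f :: "real \<Rightarrow> 'a::real_normed_vector"
  assumes "(f has_vector_derivative D) (at x)"
  shows "((\<lambda>r. (f (x + r) - f x) /\<^sub>R r) \<longlongrightarrow> D) (at 0)"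
proof -
  have "(\<lambda>r. norm (f (x + r) - f x - r *\<^sub>R D) / norm r) \<midarrow>0\<rightarrow> 0"
    using assms by (simp add: has_vector_derivative_def has_derivative_at)
  moreover have "norm (f (x + r) - f x - r *\<^sub>R D) / norm r = norm ((f (x + r) - f x) /\<^sub>R r - D)"
    if "r \<noteq> 0" for r
  proof -
    have "(f (x + r) - f x) /\<^sub>R r - D = (f (x + r) - f x - r *\<^sub>R D) /\<^sub>R r"
      using that by (simp add: scaleR_diff_right)
    then show ?thesis by (simp add: divide_inverse)
  qed
  ultimately have "(\<lambda>r. norm ((f (x + r) - f x) /\<^sub>R r - D)) \<midarrow>0\<rightarrow> 0"
    by (subst (asm) filterlim_cong[OF refl refl]) (auto simp: eventually_at_filter)
  then show ?thesis
    by (simp add: tendsto_norm_zero_iff LIM_zero_iff)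
qed

lemma filterlim_inverse_Suc_at_right: "filterlim (\<lambda>n. inverse (real (Suc n))) (at_right 0) sequentially"
  using LIMSEQ_inverse_real_of_nat by (auto simp: filterlim_at)

lemma filterlim_inverse_Suc_at: "filterlim (\<lambda>n. inverse (real (Suc n))) (at 0) sequentially"
  using LIMSEQ_inverse_real_of_nat by (auto simp: filterlim_at)

section \<open>Stability and decay of Schwartz functions\<close>

lemma schwartz_partial_deriv:
  assumes "h \<in> schwartz"
  shows "partial_deriv j h \<in> schwartz"
proof -
  have "foldr partial_deriv ks h differentiable (at x)" for ks x
    using assms unfolding schwartz_def by blast
  moreover have "bounded (range (\<lambda>x. (\<Prod>j\<in>UNIV. x $ j ^ \<alpha> j) *\<^sub>R foldr partial_deriv ks h x))" for ks \<alpha>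
    using assms unfolding schwartz_def by blast
  \<comment> \<open>\<open>foldr\<close> applies the last list entry first, so iterated derivatives
    of \<open>partial_deriv j h\<close> are those of \<open>h\<close> along lists ending in
    \<open>j\<close>.\<close>
  ultimately have "foldr partial_deriv (ks @ [j]) h differentiable (at x)"
    and "bounded (range (\<lambda>x. (\<Prod>j\<in>UNIV. x $ j ^ \<alpha> j) *\<^sub>R foldr partial_deriv (ks @ [j]) h x))" for ks x \<alpha>
    by blast+
  then show ?thesis by (simp add: schwartz_def)
qed

lemma schwartz_differentiable:
  assumes "h \<in> schwartz"
  shows "h differentiable (at x)"
proof -
  have "foldr partial_deriv [] h differentiable (at x)"
    using assms unfolding schwartz_def by blast
  then show ?thesis by simp
qed

lemma schwartz_continuous:
  assumes "h \<in> schwartz"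
  shows "continuous_on UNIV h"
  using schwartz_differentiable[OF assms]
  by (simp add: continuous_at_imp_continuous_on differentiable_imp_continuous_within)

lemma schwartz_measurable:
  assumes "h \<in> schwartz"
  shows "h \<in> borel_measurable borel"
  using schwartz_continuous[OF assms] by (rule borel_measurable_continuous_onI)

text \<open>Each factor 1 + x_k^2 splits a monomial bound into two: the exponent
  \<open>\<alpha>\<close> itself and \<open>\<alpha>\<close> raised by 2 at \<open>k\<close>. The
  induction over coordinates therefore has to be general in \<open>\<alpha>\<close>.\<close>

lemma schwartz_decay:
  fixes h :: "real^'d \<Rightarrow> complex"
  assumes "h \<in> schwartz"
  obtains C where "\<And>x. norm (h x) * vec_weight x \<le> C"
proof -
  have mono: "\<exists>C. \<forall>x. norm (h x) * (\<Prod>j\<in>UNIV. \<bar>x $ j\<bar> ^ \<alpha> j) \<le> C" for \<alpha>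
  proof -
    have "bounded (range (\<lambda>x. (\<Prod>j\<in>UNIV. x $ j ^ \<alpha> j) *\<^sub>R foldr partial_deriv [] h x))"
      using assms unfolding schwartz_def by blast
    then obtain C where "\<And>x. norm ((\<Prod>j\<in>UNIV. x $ j ^ \<alpha> j) *\<^sub>R h x) \<le> C"
      by (auto simp: bounded_iff)
    then show ?thesis
      by (intro exI[of _ C]) (simp add: abs_prod power_abs mult.commute)
  qed
  have "\<exists>C. \<forall>x. norm (h x) * (\<Prod>j\<in>UNIV. \<bar>x $ j\<bar> ^ \<alpha> j) * (\<Prod>j\<in>S. 1 + (x $ j)\<^sup>2) \<le> C"
    if "finite S" for S \<alpha>
    using that
  proof (induction arbitrary: \<alpha>)
    case empty
    then show ?case using mono by simp
  next
    case (insert k S)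
    let ?\<beta> = "\<lambda>j. \<alpha> j + (if j = k then 2 else 0)"
    obtain C where C: "\<And>x. norm (h x) * (\<Prod>j\<in>UNIV. \<bar>x $ j\<bar> ^ \<alpha> j) * (\<Prod>j\<in>S. 1 + (x $ j)\<^sup>2) \<le> C"
      using insert.IH[of \<alpha>] by blast
    obtain D where D: "\<And>x. norm (h x) * (\<Prod>j\<in>UNIV. \<bar>x $ j\<bar> ^ ?\<beta> j) * (\<Prod>j\<in>S. 1 + (x $ j)\<^sup>2) \<le> D"
      using insert.IH[of ?\<beta>] by blast
    have "(\<Prod>j\<in>UNIV. \<bar>x $ j\<bar> ^ ?\<beta> j) = (\<Prod>j\<in>UNIV. \<bar>x $ j\<bar> ^ \<alpha> j) * (x $ k)\<^sup>2" for x :: "real^'d"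
    proof -
      have "(\<Prod>j\<in>UNIV. \<bar>x $ j\<bar> ^ ?\<beta> j)
          = (\<Prod>j\<in>UNIV. \<bar>x $ j\<bar> ^ \<alpha> j) * (\<Prod>j\<in>UNIV. if j = k then \<bar>x $ j\<bar>\<^sup>2 else 1)"
        unfolding power_add prod.distrib by (intro arg_cong2[where f="(*)"] prod.cong) auto
      then show ?thesis by (simp add: prod.delta)
    qed
    then have "norm (h x) * (\<Prod>j\<in>UNIV. \<bar>x $ j\<bar> ^ \<alpha> j) * (\<Prod>j\<in>insert k S. 1 + (x $ j)\<^sup>2) \<le> C + D" for x
      using add_mono[OF C[of x] D[of x]] insert.hyps by (simp add: algebra_simps)
    then show ?case by blast
  qed
  from this[of UNIV "\<lambda>_. 0"] show ?thesis
    using that by (auto simp: vec_weight_def)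
qed

lemma schwartz_integrable:
  assumes "h \<in> schwartz"
  shows "integrable lborel h"
  using schwartz_decay[OF assms] integrable_of_weight_bound schwartz_measurable[OF assms] by metis

lemma schwartz_bounded:
  assumes "h \<in> schwartz"
  obtains B where "\<And>x. norm (h x) \<le> B"
proof -
  obtain C where C: "\<And>x. norm (h x) * vec_weight x \<le> C"
    using schwartz_decay[OF assms] by blast
  have "norm (h x) \<le> C" for x
    using mult_left_mono[OF vec_weight_ge_1, of "norm (h x)" x] C[of x] by simp
  then show ?thesis using that by blast
qed

lemma schwartz_C0:
  assumes "h \<in> schwartz"
  shows "h \<in> C0"
proof -
  obtain C where C: "\<And>x. norm (h x) * vec_weight x \<le> C"
    using schwartz_decay[OF assms] by blast
  have bound: "norm (h x) \<le> C * inverse (norm x)" if "1 \<le> norm x" for x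
  proof -
    have "norm x \<le> (norm x)\<^sup>2" using that by (simp add: self_le_power)
    then have "norm x \<le> vec_weight x"
      using one_plus_norm_le_vec_weight[of x] by linarith
    then have "norm (h x) * norm x \<le> norm (h x) * vec_weight x"
      by (simp add: mult_left_mono)
    with C[of x] have "norm (h x) * norm x \<le> C" by linarith
    moreover have "0 < norm x" using that by linarith
    ultimately show ?thesis by (simp add: field_simps)
  qed
  have "((\<lambda>x::real^'a. C * inverse (norm x)) \<longlongrightarrow> C * 0) at_infinity"
    by (intro tendsto_mult tendsto_const tendsto_inverse_0_at_top[OF filterlim_norm_at_top])
  moreover have "eventually (\<lambda>x. norm (h x) \<le> C * inverse (norm x)) at_infinity"
    using bound by (auto simp: eventually_at_infinity)
  ultimately have "(h \<longlongrightarrow> 0) at_infinity"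
    by (intro Lim_null_comparison[of h]) auto
  with schwartz_continuous[OF assms] show ?thesis by (simp add: C0_def)
qed

section \<open>Differentiation along coordinate lines and the Fourier transform\<close>

lemma has_vector_derivative_partial_deriv:
  assumes "h differentiable (at (x + s *\<^sub>R axis j 1))"
  shows "((\<lambda>s. h (x + s *\<^sub>R axis j 1)) has_vector_derivative partial_deriv j h (x + s *\<^sub>R axis j 1))
    (at s within A)"
proof -
  have D: "(h has_derivative frechet_derivative h (at (x + s *\<^sub>R axis j 1))) (at (x + s *\<^sub>R axis j 1))"
    using assms by (simp add: frechet_derivative_works)
  have lin: "linear (frechet_derivative h (at (x + s *\<^sub>R axis j 1)))"
    using D by (rule has_derivative_linear)
  have "((\<lambda>s. x + s *\<^sub>R axis j 1) has_derivative (\<lambda>r. r *\<^sub>R axis j 1)) (at s within A)"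
    by (auto intro!: derivative_eq_intros)
  from has_derivative_compose[OF this D] show ?thesis
    by (simp add: has_vector_derivative_def partial_deriv_def linear_scale[OF lin])
qed

text \<open>Mean value inequality. The derivative is bounded on the segment only, so
  \<open>B\<close> may depend on \<open>x\<close>; this is what turns a decaying derivative into a
  decaying majorant of the difference quotient.\<close>

lemma norm_diff_le_partial_deriv:
  assumes "\<And>y. h differentiable (at y)" "0 \<le> r"
    and "\<And>s. 0 \<le> s \<Longrightarrow> s \<le> r \<Longrightarrow> norm (partial_deriv j h (x + s *\<^sub>R axis j 1)) \<le> B"
  shows "norm (h (x + r *\<^sub>R axis j 1) - h x) \<le> B * r"
proof -
  have "norm (h (x + r *\<^sub>R axis j 1) - h (x + 0 *\<^sub>R axis j 1)) \<le> B * norm (r - 0)"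
  proof (rule differentiable_bound[where S="{0..r}" and f="\<lambda>s. h (x + s *\<^sub>R axis j 1)"])
    fix s assume s: "s \<in> {0..r}"
    show "((\<lambda>s. h (x + s *\<^sub>R axis j 1)) has_derivative (\<lambda>t. t *\<^sub>R partial_deriv j h (x + s *\<^sub>R axis j 1)))
        (at s within {0..r})"
      using has_vector_derivative_partial_deriv[OF assms(1)] by (simp add: has_vector_derivative_def)
    show "onorm (\<lambda>t. t *\<^sub>R partial_deriv j h (x + s *\<^sub>R axis j 1)) \<le> B"
      using assms(3)[of s] s by (intro onorm_le) (simp add: mult.commute[of B] mult_left_mono)
  qed (use assms in auto)
  then show ?thesis using assms(2) by simp
qed

text \<open>
  Translation invariance of Lebesgue measure, applied to the difference quotients of \<open>h\<close>, replaces
  integration by parts.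
\<close>
lemma fourier_partial_deriv:
  fixes h :: "real^'d \<Rightarrow> complex"
  assumes h: "h \<in> schwartz"
  shows "fourier (partial_deriv j h) \<xi> = \<i> * of_real (\<xi> $ j) * fourier h \<xi>"
proof -
  let ?e = "axis j 1 :: real^'d"
  let ?r = "\<lambda>n. inverse (real (Suc n))"
  let ?E = "\<lambda>x. exp (- \<i> * of_real (\<xi> \<bullet> x))"
  define F where "F = (LINT x|lborel. ?E x * h x)"
  note h' = schwartz_partial_deriv[OF h, of j]
  note [measurable] = schwartz_measurable[OF h] schwartz_measurable[OF h']
  obtain C where C: "\<And>x. norm (partial_deriv j h x) * vec_weight x \<le> C"
    using schwartz_decay[OF h'] by blast
  have int: "integrable lborel (\<lambda>x. ?E x * h x)"
    by (rule Bochner_Integration.integrable_bound[OF schwartz_integrable[OF h]]) (simp_all add: norm_mult)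
  \<comment> \<open>The substitution moves the shift from \<open>h\<close> to the exponential, where
    it comes out of the integral as a phase.\<close>
  have shift: "(LINT x|lborel. ?E x * h (x + r *\<^sub>R ?e)) = exp (\<i> * of_real (r * \<xi> $ j)) * F"
    "integrable lborel (\<lambda>x. ?E x * h (x + r *\<^sub>R ?e))" for r
  proof -
    define g where "g x = ?E (x - r *\<^sub>R ?e) * h x" for x
    have [measurable]: "g \<in> borel_measurable borel" unfolding g_def by measurable
    have "?E (x - r *\<^sub>R ?e) = exp (\<i> * of_real (r * \<xi> $ j)) * ?E x" for x
      by (simp add: inner_diff_right inner_axis algebra_simps flip: exp_add)
    then have g: "g x = exp (\<i> * of_real (r * \<xi> $ j)) * (?E x * h x)" for x
      by (simp add: g_def)
    have "integrable lborel g" unfolding g using int by simp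
    have eq: "(\<lambda>x. ?E x * h (x + r *\<^sub>R ?e)) = (\<lambda>x. g (r *\<^sub>R ?e + 1 *\<^sub>R x))"
      by (simp add: g_def add.commute)
    show "integrable lborel (\<lambda>x. ?E x * h (x + r *\<^sub>R ?e))"
      unfolding eq by (rule integrable_lborel_affine) (use \<open>integrable lborel g\<close> in auto)
    have "(LINT x|lborel. g x) = exp (\<i> * of_real (r * \<xi> $ j)) * F"
      unfolding g F_def by simp
    then show "(LINT x|lborel. ?E x * h (x + r *\<^sub>R ?e)) = exp (\<i> * of_real (r * \<xi> $ j)) * F"
      unfolding eq using integral_lborel_affine[of 1 g "r *\<^sub>R ?e"] by simp
  qed
  have "(\<lambda>n. LINT x|lborel. ?E x * ((h (x + ?r n *\<^sub>R ?e) - h x) /\<^sub>R ?r n))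
      \<longlonglongrightarrow> (LINT x|lborel. ?E x * partial_deriv j h x)"
  proof (rule integral_dominated_convergence)
    show "integrable lborel (\<lambda>x::real^'d. 3 ^ CARD('d) * C * inverse (vec_weight x))"
      by (intro integrable_mult_right integrable_inverse_vec_weight)
    have "(\<lambda>n. ?E x * ((h (x + ?r n *\<^sub>R ?e) - h x) /\<^sub>R ?r n)) \<longlonglongrightarrow> ?E x * partial_deriv j h x" for x
    proof -
      have "((\<lambda>s. h (x + s *\<^sub>R ?e)) has_vector_derivative partial_deriv j h (x + 0 *\<^sub>R ?e)) (at 0)"
        by (rule has_vector_derivative_partial_deriv) (rule schwartz_differentiable[OF h])
      from filterlim_compose[OF tendsto_diff_quotient[OF this] filterlim_inverse_Suc_at]
      show ?thesis by (intro tendsto_mult tendsto_const) simp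
    qed
    then show "AE x in lborel. (\<lambda>n. ?E x * ((h (x + ?r n *\<^sub>R ?e) - h x) /\<^sub>R ?r n))
        \<longlonglongrightarrow> ?E x * partial_deriv j h x" by simp
    fix n
    have "norm (?E x * ((h (x + ?r n *\<^sub>R ?e) - h x) /\<^sub>R ?r n))
        \<le> 3 ^ CARD('d) * C * inverse (vec_weight x)" for x
    proof -
      \<comment> \<open>The decay of the derivative is known at the shifted point;
        \<open>vec_weight_translate\<close> brings the weight back to \<open>x\<close>, which
        requires the step to be at most 1.\<close>
      have "norm (h (x + ?r n *\<^sub>R ?e) - h x) \<le> (3 ^ CARD('d) * C * inverse (vec_weight x)) * ?r n"
      proof (rule norm_diff_le_partial_deriv)
        fix s assume s: "0 \<le> s" "s \<le> ?r n"
        let ?p = "norm (partial_deriv j h (x + s *\<^sub>R ?e))"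
        have "?r n \<le> 1" by (simp add: field_simps)
        with s have "\<bar>s\<bar> \<le> 1" by linarith
        then have "?p * vec_weight x \<le> ?p * (3 ^ CARD('d) * vec_weight (x + s *\<^sub>R ?e))"
          by (intro mult_left_mono vec_weight_translate) auto
        also have "\<dots> \<le> 3 ^ CARD('d) * C"
          using C[of "x + s *\<^sub>R ?e"] by simp
        finally show "?p \<le> 3 ^ CARD('d) * C * inverse (vec_weight x)"
          using vec_weight_pos[of x] by (simp add: field_simps)
      qed (use schwartz_differentiable[OF h] in auto)
      moreover have "norm (?E x * (d /\<^sub>R r)) = norm d / r" if "0 < r" for d r
        using that by (simp add: norm_mult divide_inverse)
      ultimately show ?thesis
        by (simp only: pos_divide_le_eq inverse_positive_iff_positive of_nat_0_less_iff zero_less_Suc)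
    qed
    then show "AE x in lborel. norm (?E x * ((h (x + ?r n *\<^sub>R ?e) - h x) /\<^sub>R ?r n))
        \<le> 3 ^ CARD('d) * C * inverse (vec_weight x)" by simp
  qed simp_all
  \<comment> \<open>The same integrals by linearity and \<open>shift\<close>: only the quotient of
    the phase depends on \<open>n\<close>, and it converges to the derivative of the phase at
    0.\<close>
  moreover have "(LINT x|lborel. ?E x * ((h (x + ?r n *\<^sub>R ?e) - h x) /\<^sub>R ?r n))
      = ((exp (\<i> * of_real (?r n * \<xi> $ j)) - 1) /\<^sub>R ?r n) * F" for n
  proof -
    have "?E x * ((h (x + ?r n *\<^sub>R ?e) - h x) /\<^sub>R ?r n)
        = (?E x * h (x + ?r n *\<^sub>R ?e) - ?E x * h x) /\<^sub>R ?r n" for x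
      by (simp only: mult_scaleR_right right_diff_distrib)
    then have "(LINT x|lborel. ?E x * ((h (x + ?r n *\<^sub>R ?e) - h x) /\<^sub>R ?r n))
        = (LINT x|lborel. ?E x * h (x + ?r n *\<^sub>R ?e) - ?E x * h x) /\<^sub>R ?r n"
      by (simp only: integral_scaleR_right)
    also have "\<dots> = (exp (\<i> * of_real (?r n * \<xi> $ j)) * F - F) /\<^sub>R ?r n"
      by (subst Bochner_Integration.integral_diff[OF shift(2) int]) (simp only: shift F_def)
    also have "\<dots> = ((exp (\<i> * of_real (?r n * \<xi> $ j)) - 1) /\<^sub>R ?r n) * F"
      by (simp only: mult_scaleR_left left_diff_distrib mult_1)
    finally show ?thesis .
  qed
  ultimately have "(\<lambda>n. ((exp (\<i> * of_real (?r n * \<xi> $ j)) - 1) /\<^sub>R ?r n) * F)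
      \<longlonglongrightarrow> (LINT x|lborel. ?E x * partial_deriv j h x)"
    by simp
  moreover have "(\<lambda>n. ((exp (\<i> * of_real (?r n * \<xi> $ j)) - 1) /\<^sub>R ?r n) * F) \<longlonglongrightarrow> (\<i> * of_real (\<xi> $ j)) * F"
  proof -
    have "((\<lambda>s. exp (\<i> * of_real (s * \<xi> $ j))) has_vector_derivative \<i> * of_real (\<xi> $ j)) (at 0)"
      by (auto simp: has_vector_derivative_complex_iff Re_exp Im_exp intro!: derivative_eq_intros)
    from filterlim_compose[OF tendsto_diff_quotient[OF this] filterlim_inverse_Suc_at]
    show ?thesis by (intro tendsto_mult tendsto_const) simp
  qed
  ultimately have "(LINT x|lborel. ?E x * partial_deriv j h x) = (\<i> * of_real (\<xi> $ j)) * F"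
    by (rule LIMSEQ_unique)
  then show ?thesis by (simp add: fourier_def F_def)
qed

lemma fourier_bounded:
  fixes h :: "real^'d \<Rightarrow> complex"
  shows "norm (fourier h \<xi>) \<le> (2 * pi) powr (- real CARD('d) / 2) * (LINT x|lborel. norm (h x))"
proof -
  have "norm (LINT x|lborel. exp (- \<i> * of_real (\<xi> \<bullet> x)) * h x)
      \<le> (LINT x|lborel. norm (exp (- \<i> * of_real (\<xi> \<bullet> x)) * h x))"
    by (rule integral_norm_bound)
  then show ?thesis
    unfolding fourier_def norm_mult by (simp add: mult_left_mono)
qed

text \<open>Multiplying the transform by \<xi>_j^2 amounts, up to sign, to transforming the second
  partial derivative, again a Schwartz function. Hence the induction hypothesis must range over all
  Schwartz functions, and the base case is boundedness of transforms.\<close>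

lemma fourier_schwartz_decay:
  fixes h :: "real^'d \<Rightarrow> complex"
  assumes "h \<in> schwartz"
  obtains C where "\<And>\<xi>. norm (fourier h \<xi>) * vec_weight \<xi> ^ k \<le> C"
proof -
  let ?P = "\<lambda>g. \<forall>h::real^'d \<Rightarrow> complex. h \<in> schwartz \<longrightarrow> (\<exists>C. \<forall>\<xi>. norm (fourier h \<xi>) * g \<xi> \<le> C)"
  have step: "?P (\<lambda>\<xi>. (1 + (\<xi> $ j)\<^sup>2) * g \<xi>)" if P: "?P g" for g and j :: 'd
  proof (intro allI impI)
    fix h :: "real^'d \<Rightarrow> complex" assume h: "h \<in> schwartz"
    let ?h = "partial_deriv j (partial_deriv j h)"
    have h'': "?h \<in> schwartz" using h by (intro schwartz_partial_deriv)
    obtain C where C: "\<And>\<xi>. norm (fourier h \<xi>) * g \<xi> \<le> C"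
      using P h by blast
    obtain D where D: "\<And>\<xi>. norm (fourier ?h \<xi>) * g \<xi> \<le> D"
      using P h'' by blast
    have "norm (fourier ?h \<xi>) = (\<xi> $ j)\<^sup>2 * norm (fourier h \<xi>)" for \<xi>
      using h by (simp add: fourier_partial_deriv schwartz_partial_deriv norm_mult power2_eq_square)
    then have "norm (fourier h \<xi>) * ((1 + (\<xi> $ j)\<^sup>2) * g \<xi>) \<le> C + D" for \<xi>
      using add_mono[OF C[of \<xi>] D[of \<xi>]] by (simp add: algebra_simps)
    then show "\<exists>C. \<forall>\<xi>. norm (fourier h \<xi>) * ((1 + (\<xi> $ j)\<^sup>2) * g \<xi>) \<le> C" by blast
  qed
  have weight: "?P (\<lambda>\<xi>. vec_weight \<xi> * g \<xi>)" if P: "?P g" for g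
  proof -
    have "?P (\<lambda>\<xi>. (\<Prod>j\<in>S. 1 + (\<xi> $ j)\<^sup>2) * g \<xi>)" if "finite S" for S
      using that
    proof induction
      case (insert j S)
      from step[OF insert.IH, of j] insert.hyps show ?case
        by (simp add: mult.assoc)
    qed (use P in simp)
    then show ?thesis by (simp add: vec_weight_def)
  qed
  have "?P (\<lambda>\<xi>. vec_weight \<xi> ^ k)"
  proof (induction k)
    case 0
    show ?case using fourier_bounded by auto
  next
    case (Suc k)
    from weight[OF Suc] show ?case by simp
  qed
  then show ?thesis using assms that by blast
qed

lemma fourier_measurable:
  assumes [measurable]: "h \<in> borel_measurable borel"
  shows "fourier h \<in> borel_measurable borel"
  unfolding fourier_def by measurable

lemma fourier_schwartz_integrable:
  assumes "h \<in> schwartz"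
  shows "integrable lborel (fourier h)"
  using fourier_schwartz_decay[OF assms, of 1] integrable_of_weight_bound
    fourier_measurable[OF schwartz_measurable[OF assms]] by (metis power_one_right)

subsection \<open>Fourier inversion\<close>

text \<open>Left unnormalised: its value 1 at the origin makes
  \<open>vec_gauss (\<epsilon> *\<^sub>R \<xi>)\<close> a damping factor that tends to 1, and its
  total mass cancels the constant in the Fourier transform.\<close>

definition vec_gauss :: "real^'d \<Rightarrow> real" where
  "vec_gauss x = exp (- (norm x)\<^sup>2 / 2)"

lemma vec_gauss_prod: "vec_gauss x = (\<Prod>j\<in>UNIV. exp (- (x $ j)\<^sup>2 / 2))"
proof -
  have "(norm x)\<^sup>2 = (\<Sum>j\<in>UNIV. (x $ j)\<^sup>2)"
    by (simp add: norm_vec_def L2_set_def sum_nonneg)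
  then show ?thesis
    by (simp add: vec_gauss_def sum_divide_distrib flip: exp_sum sum_negf)
qed

lemma vec_gauss_measurable [measurable]: "vec_gauss \<in> borel_measurable borel"
  unfolding vec_gauss_def by measurable

lemma vec_gauss_minus: "vec_gauss (- x) = vec_gauss x"
  by (simp add: vec_gauss_def)

lemma powr_half_card: "(2 * pi) powr (- real CARD('d) / 2) = inverse (sqrt (2 * pi) ^ CARD('d::finite))"
proof -
  have "sqrt (2 * pi) ^ CARD('d) = (2 * pi) powr (real CARD('d) / 2)"
    by (simp add: powr_half_sqrt[symmetric] powr_powr flip: powr_realpow)
  then show ?thesis by (simp add: powr_minus)
qed

text \<open>Gaussian and phase both factor over coordinates, and each factor is the characteristic
  function of the standard normal law up to \<open>sqrt (2 * pi)\<close>.\<close>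

lemma
  shows integrable_iexp_vec_gauss:
      "integrable lborel (\<lambda>x::real^'d. iexp (u \<bullet> x) * of_real (vec_gauss x))"
    and integral_iexp_vec_gauss:
      "(LINT x|lborel. iexp (u \<bullet> x) * of_real (vec_gauss x))
        = of_real (sqrt (2 * pi) ^ CARD('d) * vec_gauss (u :: real^'d))"
proof -
  let ?f = "\<lambda>j y. iexp (u $ j * y) * of_real (exp (- y\<^sup>2 / 2))"
  have eq: "iexp (u \<bullet> x) * of_real (vec_gauss x) = (\<Prod>j\<in>UNIV. ?f j (x $ j))" for x
    by (simp add: vec_gauss_prod inner_vec_def sum_distrib_left exp_sum prod.distrib of_real_prod)
  have dens: "?f j y = sqrt (2 * pi) *\<^sub>R (std_normal_density y *\<^sub>R iexp (u $ j * y))" for j y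
    by (simp add: std_normal_density_def scaleR_conv_of_real)
  have int: "integrable lborel (\<lambda>y. std_normal_density y *\<^sub>R iexp (u $ j * y))" for j
    by (rule Bochner_Integration.integrable_bound[OF integrable_normal_density[of 1 0]]) auto
  have "integrable lborel (?f j)" for j
    unfolding dens by (intro integrable_scaleR_right int)
  note f = this
  show "integrable lborel (\<lambda>x::real^'d. iexp (u \<bullet> x) * of_real (vec_gauss x))"
    unfolding eq by (rule integrable_lborel_vec_prod) (rule f)
  have "(LINT y|lborel. ?f j y) = of_real (sqrt (2 * pi) * exp (- (u $ j)\<^sup>2 / 2))" for j
  proof -
    have "(LINT y|lborel. ?f j y) = sqrt (2 * pi) *\<^sub>R char std_normal_distribution (u $ j)"
      unfolding dens char_def integral_scaleR_right by (simp add: integral_density)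
    then show ?thesis
      by (simp add: char_std_normal_distribution scaleR_conv_of_real)
  qed
  then show "(LINT x|lborel. iexp (u \<bullet> x) * of_real (vec_gauss x))
      = of_real (sqrt (2 * pi) ^ CARD('d) * vec_gauss u)"
    unfolding eq by (subst integral_lborel_vec_prod[OF f]) (simp add: prod.distrib vec_gauss_prod)
qed

lemma integrable_vec_gauss: "integrable lborel (vec_gauss :: real^'d \<Rightarrow> real)"
  and integral_vec_gauss: "(LINT x|lborel. vec_gauss (x::real^'d)) = sqrt (2 * pi) ^ CARD('d)"
proof -
  have i: "integrable lborel (\<lambda>x::real^'d. complex_of_real (vec_gauss x))"
    using integrable_iexp_vec_gauss[of 0] by simp
  then show "integrable lborel (vec_gauss :: real^'d \<Rightarrow> real)"
    using integrable_Re by fastforce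
  have "complex_of_real (LINT x|lborel. vec_gauss (x::real^'d)) = complex_of_real (sqrt (2 * pi) ^ CARD('d))"
    using integral_iexp_vec_gauss[of "0::real^'d"] by (simp add: vec_gauss_def)
  then show "(LINT x|lborel. vec_gauss (x::real^'d)) = sqrt (2 * pi) ^ CARD('d)"
    by (simp only: of_real_eq_iff)
qed

text \<open>Damping the inversion integral permits Fubini for any integrable \<open>h\<close>. The
  \<xi>-integral then becomes an explicit Gaussian kernel, and inversion turns into convolution with
  an approximate identity of width \<open>\<epsilon>\<close>.\<close>

lemma fourier_gauss_regularisation:
  fixes h :: "real^'d \<Rightarrow> complex"
  assumes h: "integrable lborel h" and "0 < \<epsilon>"
  shows "(LINT \<xi>|lborel. of_real (vec_gauss (\<epsilon> *\<^sub>R \<xi>)) * iexp (\<xi> \<bullet> x) * fourier h \<xi>)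
    = (LINT z|lborel. h (x + \<epsilon> *\<^sub>R z) * of_real (vec_gauss z))"
proof -
  define c :: real where "c = (2 * pi) powr (- real CARD('d) / 2)"
  have c: "c * sqrt (2 * pi) ^ CARD('d) = 1"
    unfolding c_def powr_half_card by simp
  have [measurable]: "h \<in> borel_measurable borel"
    using h by (auto dest: borel_measurable_integrable)
  \<comment> \<open>The Gaussian is its own transform up to a constant; substituting \<epsilon>\<xi>
    for \<xi> in that identity moves the scale to the argument \<open>u\<close>.\<close>
  have kernel: "(LINT \<xi>|lborel. of_real (vec_gauss (\<epsilon> *\<^sub>R \<xi>)) * iexp (\<xi> \<bullet> u))
      = of_real (sqrt (2 * pi) ^ CARD('d) * vec_gauss (u /\<^sub>R \<epsilon>) / \<epsilon> ^ CARD('d))" for u :: "real^'d"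
  proof -
    have "(LINT \<xi>|lborel. iexp ((u /\<^sub>R \<epsilon>) \<bullet> \<xi>) * of_real (vec_gauss \<xi>))
        = \<epsilon> ^ CARD('d) *\<^sub>R (LINT \<xi>|lborel. iexp ((u /\<^sub>R \<epsilon>) \<bullet> (0 + \<epsilon> *\<^sub>R \<xi>)) * of_real (vec_gauss (0 + \<epsilon> *\<^sub>R \<xi>)))"
      using \<open>0 < \<epsilon>\<close>
      by (subst integral_lborel_affine[where c=\<epsilon> and t=0]) (auto simp: DIM_cart)
    moreover have "iexp ((u /\<^sub>R \<epsilon>) \<bullet> (0 + \<epsilon> *\<^sub>R \<xi>)) * of_real (vec_gauss (0 + \<epsilon> *\<^sub>R \<xi>))
        = of_real (vec_gauss (\<epsilon> *\<^sub>R \<xi>)) * iexp (\<xi> \<bullet> u)" for \<xi>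
    proof -
      have "(u /\<^sub>R \<epsilon>) \<bullet> (0 + \<epsilon> *\<^sub>R \<xi>) = \<xi> \<bullet> u"
        using \<open>0 < \<epsilon>\<close> by (simp add: inner_commute)
      then show ?thesis by (simp only: mult.commute add_0)
    qed
    ultimately have "of_real (sqrt (2 * pi) ^ CARD('d) * vec_gauss (u /\<^sub>R \<epsilon>))
        = of_real (\<epsilon> ^ CARD('d)) * (LINT \<xi>|lborel. of_real (vec_gauss (\<epsilon> *\<^sub>R \<xi>)) * iexp (\<xi> \<bullet> u))"
      by (simp only: integral_iexp_vec_gauss scaleR_conv_of_real[of _ "_ :: complex"])
    then show ?thesis
      using \<open>0 < \<epsilon>\<close> by (simp only: of_real_divide) (simp add: eq_divide_eq mult.commute)
  qed
  let ?k = "\<lambda>\<xi> y. of_real (vec_gauss (\<epsilon> *\<^sub>R \<xi>)) * iexp (\<xi> \<bullet> (x - y)) * h y"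
  \<comment> \<open>The phase has modulus 1 and gives no decay, so integrability in \<xi> comes from
    the damping factor and integrability in \<open>y\<close> from \<open>h\<close>.\<close>
  have int: "integrable (lborel \<Otimes>\<^sub>M lborel) (\<lambda>(\<xi>, y). ?k \<xi> y)"
  proof (rule Bochner_Integration.integrable_bound)
    have "integrable lborel (\<lambda>\<xi>::real^'d. vec_gauss (0 + \<epsilon> *\<^sub>R \<xi>))"
      using \<open>0 < \<epsilon>\<close> by (intro integrable_lborel_affine integrable_vec_gauss) auto
    from integrable_abs[OF this]
    show "integrable (lborel \<Otimes>\<^sub>M lborel) (\<lambda>(\<xi> :: real^'d, y). of_real (vec_gauss (\<epsilon> *\<^sub>R \<xi>)) * h y)"
      using h by (intro lborel_pair.Fubini_integrable) (auto simp: norm_mult split_beta')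
    show "AE p in lborel \<Otimes>\<^sub>M lborel. norm (case p of (\<xi>, y) \<Rightarrow> ?k \<xi> y)
        \<le> norm (case p of (\<xi>, y) \<Rightarrow> of_real (vec_gauss (\<epsilon> *\<^sub>R \<xi>)) * h y)"
      by (auto simp: norm_mult)
  qed measurable
  have "of_real (vec_gauss (\<epsilon> *\<^sub>R \<xi>)) * iexp (\<xi> \<bullet> x) * fourier h \<xi> = of_real c * (LINT y|lborel. ?k \<xi> y)" for \<xi>
  proof -
    let ?a = "of_real (vec_gauss (\<epsilon> *\<^sub>R \<xi>)) * iexp (\<xi> \<bullet> x)"
    have "?k \<xi> y = ?a * (exp (- \<i> * of_real (\<xi> \<bullet> y)) * h y)" for y
      by (simp add: inner_diff_right right_diff_distrib exp_diff exp_minus field_simps)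
    then have "(LINT y|lborel. ?k \<xi> y) = ?a * (LINT y|lborel. exp (- \<i> * of_real (\<xi> \<bullet> y)) * h y)"
      by (simp only: integral_mult_right_zero)
    then show ?thesis by (simp add: fourier_def c_def mult_ac)
  qed
  then have "(LINT \<xi>|lborel. of_real (vec_gauss (\<epsilon> *\<^sub>R \<xi>)) * iexp (\<xi> \<bullet> x) * fourier h \<xi>)
      = of_real c * (LINT \<xi>|lborel. (LINT y|lborel. ?k \<xi> y))"
    by simp
  also have "(LINT \<xi>|lborel. (LINT y|lborel. ?k \<xi> y)) = (LINT y|lborel. (LINT \<xi>|lborel. ?k \<xi> y))"
    by (rule lborel_pair.Fubini_integral[symmetric]) (rule int)
  also have "of_real c * \<dots>
      = (LINT y|lborel. of_real (vec_gauss ((x - y) /\<^sub>R \<epsilon>) / \<epsilon> ^ CARD('d)) * h y)"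
  proof -
    have "of_real c * (LINT \<xi>|lborel. ?k \<xi> y) = of_real (vec_gauss ((x - y) /\<^sub>R \<epsilon>) / \<epsilon> ^ CARD('d)) * h y" for y
    proof -
      have "of_real c * (LINT \<xi>|lborel. ?k \<xi> y)
          = of_real ((c * sqrt (2 * pi) ^ CARD('d)) * vec_gauss ((x - y) /\<^sub>R \<epsilon>) / \<epsilon> ^ CARD('d)) * h y"
        by (subst integral_mult_left_zero, subst kernel) simp
      then show ?thesis by (simp add: c)
    qed
    then show ?thesis by (simp flip: integral_mult_right_zero)
  qed
  \<comment> \<open>Substitution y = x + \<epsilon>z; its Jacobian cancels the power of \<epsilon>
    in the kernel.\<close>
  also have "\<dots> = \<epsilon> ^ CARD('d) *\<^sub>R
      (LINT z|lborel. of_real (vec_gauss ((x - (x + \<epsilon> *\<^sub>R z)) /\<^sub>R \<epsilon>) / \<epsilon> ^ CARD('d)) * h (x + \<epsilon> *\<^sub>R z))"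
    using \<open>0 < \<epsilon>\<close> by (subst integral_lborel_affine[where c=\<epsilon> and t=x]) (auto simp: DIM_cart)
  also have "\<dots> = (LINT z|lborel. h (x + \<epsilon> *\<^sub>R z) * of_real (vec_gauss z))"
  proof -
    have "(x - (x + \<epsilon> *\<^sub>R z)) /\<^sub>R \<epsilon> = - z" for z
      using \<open>0 < \<epsilon>\<close> by simp
    moreover have "\<epsilon> ^ CARD('d) *\<^sub>R (of_real (a / \<epsilon> ^ CARD('d)) * w) = w * of_real a" for a and w :: complex
      using \<open>0 < \<epsilon>\<close> by (simp add: scaleR_conv_of_real)
    ultimately show ?thesis
      unfolding integral_scaleR_right[symmetric] by (simp only: vec_gauss_minus)
  qed
  finally show ?thesis .
qed

text \<open>Send \<epsilon> to 0 on both sides of the regularised identity. The transform dominates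
  one side, a Gaussian times the bound \<open>B\<close> the other; continuity of \<open>h\<close>
  gives the value at every point, not just almost everywhere.\<close>

theorem fourier_inversion:
  fixes h :: "real^'d \<Rightarrow> complex"
  assumes h: "integrable lborel h" "continuous_on UNIV h" "\<And>x. norm (h x) \<le> B"
    and fh: "integrable lborel (fourier h)"
  shows "h x = of_real ((2 * pi) powr (- real CARD('d) / 2)) * (LINT \<xi>|lborel. iexp (\<xi> \<bullet> x) * fourier h \<xi>)"
proof -
  let ?\<epsilon> = "\<lambda>n. inverse (real (Suc n))"
  have [measurable]: "h \<in> borel_measurable borel" "fourier h \<in> borel_measurable borel"
    using h(1) fh by (auto dest: borel_measurable_integrable)
  have scale: "(\<lambda>n. a + ?\<epsilon> n *\<^sub>R z) \<longlonglongrightarrow> a" for a z :: "real^'d"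
    using tendsto_add[OF tendsto_const tendsto_scaleR[OF LIMSEQ_inverse_real_of_nat tendsto_const], of a z]
    by simp
  have "(\<lambda>n. LINT z|lborel. h (x + ?\<epsilon> n *\<^sub>R z) * of_real (vec_gauss z))
      \<longlonglongrightarrow> (LINT z|lborel. h x * of_real (vec_gauss (z::real^'d)))"
  proof (rule integral_dominated_convergence)
    show "integrable lborel (\<lambda>z::real^'d. B * vec_gauss z)"
      by (intro integrable_mult_right integrable_vec_gauss)
    have "isCont h x" using h(2) by (simp add: continuous_on_eq_continuous_at)
    then show "AE z in lborel. (\<lambda>n. h (x + ?\<epsilon> n *\<^sub>R z) * of_real (vec_gauss z)) \<longlonglongrightarrow> h x * of_real (vec_gauss z)"
      by (intro AE_I2 tendsto_mult tendsto_const isCont_tendsto_compose[OF _ scale])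
    show "AE z in lborel. norm (h (x + ?\<epsilon> n *\<^sub>R z) * of_real (vec_gauss z)) \<le> B * vec_gauss z" for n
      using h(3) by (auto simp: norm_mult vec_gauss_def intro!: mult_right_mono)
  qed simp_all
  moreover have "(\<lambda>n. LINT \<xi>|lborel. of_real (vec_gauss (?\<epsilon> n *\<^sub>R \<xi>)) * iexp (\<xi> \<bullet> x) * fourier h \<xi>)
      \<longlonglongrightarrow> (LINT \<xi>|lborel. iexp (\<xi> \<bullet> x) * fourier h \<xi>)"
  proof (rule integral_dominated_convergence[where w="\<lambda>\<xi>. norm (fourier h \<xi>)"])
    show "AE \<xi> in lborel. (\<lambda>n. of_real (vec_gauss (?\<epsilon> n *\<^sub>R \<xi>)) * iexp (\<xi> \<bullet> x) * fourier h \<xi>)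
        \<longlonglongrightarrow> iexp (\<xi> \<bullet> x) * fourier h \<xi>"
    proof (rule AE_I2)
      fix \<xi> :: "real^'d"
      have "isCont (vec_gauss :: real^'d \<Rightarrow> real) 0" unfolding vec_gauss_def by (intro continuous_intros) auto
      then have "(\<lambda>n. vec_gauss (0 + ?\<epsilon> n *\<^sub>R \<xi>)) \<longlonglongrightarrow> vec_gauss (0 :: real^'d)"
        by (rule isCont_tendsto_compose) (rule scale)
      then have "(\<lambda>n. complex_of_real (vec_gauss (?\<epsilon> n *\<^sub>R \<xi>))) \<longlonglongrightarrow> of_real 1"
        by (intro tendsto_of_real) (simp add: vec_gauss_def)
      from tendsto_mult[OF tendsto_mult[OF this tendsto_const] tendsto_const]
      show "(\<lambda>n. of_real (vec_gauss (?\<epsilon> n *\<^sub>R \<xi>)) * iexp (\<xi> \<bullet> x) * fourier h \<xi>)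
          \<longlonglongrightarrow> iexp (\<xi> \<bullet> x) * fourier h \<xi>" by simp
    qed
    have "norm (vec_gauss z) \<le> 1" for z :: "real^'d" by (simp add: vec_gauss_def)
    then show "AE \<xi> in lborel. norm (of_real (vec_gauss (?\<epsilon> n *\<^sub>R \<xi>)) * iexp (\<xi> \<bullet> x) * fourier h \<xi>)
        \<le> norm (fourier h \<xi>)" for n
      by (auto simp: norm_mult intro!: mult_left_le_one_le)
  qed (use fh in simp_all)
  ultimately have "(LINT \<xi>|lborel. iexp (\<xi> \<bullet> x) * fourier h \<xi>) = (LINT z|lborel. h x * of_real (vec_gauss (z::real^'d)))"
    using fourier_gauss_regularisation[OF h(1)] by (auto intro: LIMSEQ_unique)
  also have "\<dots> = h x * of_real (sqrt (2 * pi) ^ CARD('d))"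
    using integrable_vec_gauss by (simp add: integral_vec_gauss)
  finally show ?thesis
    unfolding powr_half_card by simp
qed

lemma schwartz_fourier_inversion:
  fixes h :: "real^'d \<Rightarrow> complex"
  assumes h: "h \<in> schwartz"
  shows "h x = of_real ((2 * pi) powr (- real CARD('d) / 2)) * (LINT \<xi>|lborel. iexp (\<xi> \<bullet> x) * fourier h \<xi>)"
proof -
  obtain B where "\<And>x. norm (h x) \<le> B" using schwartz_bounded[OF h] by blast
  then show ?thesis
    by (intro fourier_inversion schwartz_integrable[OF h] schwartz_continuous[OF h]
        fourier_schwartz_integrable[OF h])
qed

subsection \<open>Levy exponents\<close>

lemma axis_nonneg: "0 \<le> r \<Longrightarrow> 0 \<le> r *\<^sub>R axis j (1::real)"
  by (simp add: less_eq_vec_def axis_def)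

text \<open>
  While \<open>exp (t z)\<close> stays within distance \<open>1/2\<close> of \<open>1\<close>, its real part stays positive, so
  \<open>t \<bar>Im z\<bar>\<close> cannot reach \<open>pi / 2\<close>.
\<close>
lemma exponent_bound_of_exp_near_1:
  assumes "0 < t0" and near: "\<And>t. 0 \<le> t \<Longrightarrow> t \<le> t0 \<Longrightarrow> norm (exp (of_real t * z) - 1) \<le> 1 / 2"
  shows "\<bar>Im z\<bar> \<le> pi / (2 * t0)" and "- ln 2 / t0 \<le> Re z"
proof -
  show "\<bar>Im z\<bar> \<le> pi / (2 * t0)"
  proof (rule ccontr)
    assume "\<not> \<bar>Im z\<bar> \<le> pi / (2 * t0)"
    then have gt: "pi / (2 * t0) < \<bar>Im z\<bar>" by simp
    then have pos: "0 < \<bar>Im z\<bar>" using \<open>0 < t0\<close> by (smt (verit) divide_pos_pos pi_gt_zero)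
    \<comment> \<open>The time at which \<open>exp (t z)\<close> reaches the imaginary axis, where
      its distance from 1 is at least 1.\<close>
    define t where "t = pi / (2 * \<bar>Im z\<bar>)"
    have t: "0 \<le> t" "t \<le> t0" "t * \<bar>Im z\<bar> = pi / 2"
      using gt pos \<open>0 < t0\<close> by (simp_all add: t_def field_simps)
    have "cos (t * Im z) = cos \<bar>t * Im z\<bar>" by simp
    also have "\<bar>t * Im z\<bar> = pi / 2" using t by (simp add: abs_mult)
    finally have "Re (exp (of_real t * z) - 1) = - 1" by (simp add: Re_exp)
    then have "1 \<le> norm (exp (of_real t * z) - 1)"
      using abs_Re_le_cmod[of "exp (of_real t * z) - 1"] by simp
    with near[OF t(1,2)] show False by simp
  qed
  \<comment> \<open>At \<open>t0\<close> the modulus, which is \<open>exp (t0 * Re z)\<close>, is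
    still at least 1/2; taking logarithms bounds the real part from below.\<close>
  have "1 - norm (exp (of_real t0 * z)) \<le> norm (exp (of_real t0 * z) - 1)"
    using norm_triangle_ineq2[of 1 "exp (of_real t0 * z)"] by (simp add: norm_minus_commute)
  also have "\<dots> \<le> 1 / 2" using near[of t0] \<open>0 < t0\<close> by simp
  finally have "1 / 2 \<le> exp (t0 * Re z)" by simp
  then have "ln (1 / 2) \<le> ln (exp (t0 * Re z))" by (subst ln_le_cancel_iff) auto
  then have "ln (1 / 2) \<le> t0 * Re z" by simp
  then show "- ln 2 / t0 \<le> Re z" using \<open>0 < t0\<close> by (simp add: ln_div field_simps)
qed

section \<open>Characteristic functions of the process and growth of the exponent\<close>

context multiparameter_levy_process
begin

text \<open>Kept apart from the exponential of the exponent: as an expectation it inherits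
  measurability, the bound 1 and pointwise trigonometric inequalities, which are then passed to the
  exponent.\<close>

definition char_fun :: "real^'n \<Rightarrow> real^'d \<Rightarrow> complex" where
  "char_fun t \<xi> = (LINT \<omega>|M. iexp (\<xi> \<bullet> X t \<omega>))"

lemma integrable_iexp_X:
  assumes "0 \<le> t"
  shows "integrable M (\<lambda>\<omega>. iexp (\<xi> \<bullet> X t \<omega>))"
proof -
  note [measurable] = random_variable_X[OF assms]
  show ?thesis by (rule integrable_const_bound[where B=1]) auto
qed

lemma norm_char_fun_le: "norm (char_fun t \<xi>) \<le> 1"
proof -
  have "norm (char_fun t \<xi>) \<le> (LINT \<omega>|M. norm (iexp (\<xi> \<bullet> X t \<omega>)))"
    unfolding char_fun_def by (rule integral_norm_bound)
  then show ?thesis by (simp add: prob_space)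
qed

lemma char_fun_measurable:
  assumes "0 \<le> t"
  shows "char_fun t \<in> borel_measurable borel"
proof -
  note [measurable] = random_variable_X[OF assms]
  show ?thesis unfolding char_fun_def by measurable
qed

lemma char_fun_0: "char_fun 0 \<xi> = 1"
proof -
  have "char_fun 0 \<xi> = (LINT \<omega>|M. 1)"
    unfolding char_fun_def
  proof (rule integral_cong_AE)
    show "AE \<omega> in M. iexp (\<xi> \<bullet> X 0 \<omega>) = 1"
      using starts_at_0 by eventually_elim simp
    show "(\<lambda>\<omega>. iexp (\<xi> \<bullet> X 0 \<omega>)) \<in> borel_measurable M"
      using integrable_iexp_X[of 0] by (auto dest: borel_measurable_integrable)
  qed simp
  then show ?thesis by (simp add: prob_space)
qed

text \<open>The chain 0, \<open>s\<close>, \<open>s + t\<close> has two independent increments. The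
  first is almost surely \<open>X s\<close> because the process starts at 0; the second has the law
  of \<open>X t\<close> by stationarity.\<close>

lemma char_fun_add:
  assumes "0 \<le> s" "0 \<le> t"
  shows "char_fun (s + t) \<xi> = char_fun s \<xi> * char_fun t \<xi>"
proof -
  have st: "0 \<le> s + t" using assms by (rule add_nonneg_nonneg)
  note [measurable] = random_variable_X[OF assms(1)] random_variable_X[OF assms(2)]
    random_variable_X[OF st] random_variable_X[OF order_refl]
  \<comment> \<open>Chains are indexed by all naturals; only the values at 0, 1, 2 matter for the
    two increments, so the sequence is constant from 2 on.\<close>
  define \<tau> :: "nat \<Rightarrow> real^'n" where "\<tau> j = (if j = 0 then 0 else if j = 1 then s else s + t)" for j
  define Y where "Y j \<omega> = X (\<tau> (Suc j)) \<omega> - X (\<tau> j) \<omega>" for j \<omega>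
  have mono: "\<tau> j \<le> \<tau> (Suc j)" if "j < 2" for j
    using that assms by (auto simp: \<tau>_def less_Suc_eq numeral_2_eq_2)
  have "indep_vars (\<lambda>_. borel) Y {..<2}"
    unfolding Y_def by (rule independent_increments) (simp add: \<tau>_def, rule mono)
  then have ind: "indep_vars (\<lambda>_. borel) (\<lambda>j \<omega>. iexp (\<xi> \<bullet> Y j \<omega>)) {..<2}"
    by (rule indep_vars_compose2[where Y="\<lambda>_ y. iexp (\<xi> \<bullet> y)"]) simp
  have [measurable]: "Y j \<in> borel_measurable M" for j
    unfolding Y_def \<tau>_def by simp
  have int: "integrable M (\<lambda>\<omega>. iexp (\<xi> \<bullet> Y j \<omega>))" for j
    by (rule integrable_const_bound[where B=1]) auto
  have "(LINT \<omega>|M. (\<Prod>j<2. iexp (\<xi> \<bullet> Y j \<omega>))) = (\<Prod>j<2. LINT \<omega>|M. iexp (\<xi> \<bullet> Y j \<omega>))"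
    by (rule indep_vars_lebesgue_integral[OF _ ind int]) simp
  moreover have "(LINT \<omega>|M. (\<Prod>j<2. iexp (\<xi> \<bullet> Y j \<omega>))) = char_fun (s + t) \<xi>"
    unfolding char_fun_def
  proof (rule integral_cong_AE)
    show "AE \<omega> in M. (\<Prod>j<2. iexp (\<xi> \<bullet> Y j \<omega>)) = iexp (\<xi> \<bullet> X (s + t) \<omega>)"
      using starts_at_0
      by eventually_elim
        (simp add: Y_def \<tau>_def numeral_2_eq_2 inner_diff_right algebra_simps flip: exp_add)
  qed measurable
  moreover have "(LINT \<omega>|M. iexp (\<xi> \<bullet> Y 0 \<omega>)) = char_fun s \<xi>"
    unfolding char_fun_def
  proof (rule integral_cong_AE)
    show "AE \<omega> in M. iexp (\<xi> \<bullet> Y 0 \<omega>) = iexp (\<xi> \<bullet> X s \<omega>)"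
      using starts_at_0 by eventually_elim (simp add: Y_def \<tau>_def)
  qed measurable
  moreover have "(LINT \<omega>|M. iexp (\<xi> \<bullet> Y 1 \<omega>)) = char_fun t \<xi>"
  proof -
    have "(LINT \<omega>|M. iexp (\<xi> \<bullet> Y 1 \<omega>))
        = (LINT y|distr M borel (\<lambda>\<omega>. X (s + t) \<omega> - X s \<omega>). iexp (\<xi> \<bullet> y))"
      by (subst integral_distr) (auto simp: Y_def \<tau>_def)
    also have "\<dots> = char_fun t \<xi>"
      unfolding stationary_increments[OF assms] char_fun_def by (subst integral_distr) auto
    finally show ?thesis .
  qed
  ultimately show ?thesis by (simp add: numeral_2_eq_2)
qed

text \<open>The exponent is given on the axes only. Writing \<open>t\<close> as the sum of its axis
  components, all in the orthant, \<open>char_fun_add\<close> multiplies the axis values.\<close>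

lemma char_fun_exponent:
  assumes \<Psi>: "levy_exponent M X \<Psi>" and "0 \<le> t"
  shows "char_fun t \<xi> = exp (\<Sum>j\<in>UNIV. of_real (t $ j) * \<Psi> \<xi> $ j)"
proof -
  have axis: "0 \<le> t $ j *\<^sub>R axis j (1::real)" for j
    using \<open>0 \<le> t\<close> by (intro axis_nonneg) (simp add: less_eq_vec_def)
  have *: "char_fun (\<Sum>j\<in>S. t $ j *\<^sub>R axis j 1) \<xi> = exp (\<Sum>j\<in>S. of_real (t $ j) * \<Psi> \<xi> $ j)" if "finite S" for S
    using that
  proof induction
    case empty
    show ?case by (simp add: char_fun_0)
  next
    case (insert j S)
    have "char_fun (t $ j *\<^sub>R axis j 1) \<xi> = exp (of_real (t $ j) * \<Psi> \<xi> $ j)"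
      using \<Psi> \<open>0 \<le> t\<close> by (simp add: levy_exponent_def char_fun_def less_eq_vec_def)
    moreover have "0 \<le> (\<Sum>j\<in>S. t $ j *\<^sub>R axis j (1::real))"
      by (rule sum_nonneg) (rule axis)
    ultimately show ?case
      using insert axis by (simp add: char_fun_add exp_add)
  qed
  have "(\<Sum>j\<in>UNIV. t $ j *\<^sub>R axis j 1) = t"
    using basis_expansion[of t] by (simp add: scalar_mult_eq_scaleR)
  then show ?thesis using *[of UNIV] by simp
qed

lemma char_fun_axis:
  assumes "levy_exponent M X \<Psi>" "0 \<le> r"
  shows "char_fun (r *\<^sub>R axis j 1) \<xi> = exp (of_real r * \<Psi> \<xi> $ j)"
  using assms by (simp add: levy_exponent_def char_fun_def)

text \<open>At time 1 on the axis the characteristic function has modulus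
  \<open>exp (Re (\<Psi> \<xi> $ j))\<close>, and this is at most 1.\<close>

lemma Re_exponent_le_0:
  assumes "levy_exponent M X \<Psi>"
  shows "Re (\<Psi> \<xi> $ j) \<le> 0"
  using norm_char_fun_le[of "1 *\<^sub>R axis j 1" \<xi>] char_fun_axis[OF assms, of 1] by simp

text \<open>Recovers the exponent from expectations. Measurability and the doubling inequality reach
  it through this limit.\<close>

lemma exponent_quotient:
  assumes "levy_exponent M X \<Psi>"
  shows "(\<lambda>n. (char_fun (inverse (real (Suc n)) *\<^sub>R axis j 1) \<xi> - 1) /\<^sub>R inverse (real (Suc n)))
    \<longlonglongrightarrow> \<Psi> \<xi> $ j"
proof -
  have "((\<lambda>r. exp (of_real r * \<Psi> \<xi> $ j)) has_vector_derivative \<Psi> \<xi> $ j) (at 0)"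
    by (rule has_vector_derivative_real_field) (auto intro!: derivative_eq_intros)
  from filterlim_compose[OF tendsto_diff_quotient[OF this] filterlim_inverse_Suc_at]
  show ?thesis by (simp add: char_fun_axis[OF assms] del: of_nat_Suc)
qed

lemma exponent_measurable:
  assumes "levy_exponent M X \<Psi>"
  shows "(\<lambda>\<xi>. \<Psi> \<xi> $ j) \<in> borel_measurable borel"
proof (rule borel_measurable_LIMSEQ_metric)
  show "(\<lambda>\<xi>. (char_fun (inverse (real (Suc n)) *\<^sub>R axis j 1) \<xi> - 1) /\<^sub>R inverse (real (Suc n)))
      \<in> borel_measurable borel" for n
    using char_fun_measurable[OF axis_nonneg, of "inverse (real (Suc n))" j] by measurable
qed (rule exponent_quotient[OF assms])

text \<open>Expectations of the pointwise inequalities \<open>cos2\<close> and \<open>sin2\<close>.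
  The imaginary part doubles up to an error controlled by 1 minus the real part; every term is of
  first order as time tends to 0, so the inequalities survive division by time.\<close>

lemma one_minus_Re_char_fun_double:
  assumes "0 \<le> t"
  shows "1 - Re (char_fun t (2 *\<^sub>R \<xi>)) \<le> 4 * (1 - Re (char_fun t \<xi>))"
    and "\<bar>Im (char_fun t (2 *\<^sub>R \<xi>)) - 2 * Im (char_fun t \<xi>)\<bar> \<le> 2 * (1 - Re (char_fun t \<xi>))"
proof -
  note [measurable] = random_variable_X[OF assms]
  have bnd: "integrable M f" if "f \<in> borel_measurable M" "\<And>\<omega>. \<bar>f \<omega>\<bar> \<le> 1" for f :: "'w \<Rightarrow> real"
    by (rule integrable_const_bound[where B=1]) (use that in auto)
  have re: "Re (char_fun t \<xi>) = (LINT \<omega>|M. cos (\<xi> \<bullet> X t \<omega>))"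
    and im: "Im (char_fun t \<xi>) = (LINT \<omega>|M. sin (\<xi> \<bullet> X t \<omega>))" for \<xi>
    unfolding char_fun_def using integrable_iexp_X[OF assms, of \<xi>]
    by (simp_all add: Re_exp Im_exp flip: integral_Re integral_Im)
  have int [simp]: "integrable M (\<lambda>\<omega>. cos (\<xi> \<bullet> X t \<omega>))" "integrable M (\<lambda>\<omega>. sin (\<xi> \<bullet> X t \<omega>))" for \<xi>
    by (auto intro: bnd)
  have one: "1 - Re (char_fun t \<xi>) = (LINT \<omega>|M. 1 - cos (\<xi> \<bullet> X t \<omega>))" for \<xi>
    by (simp add: re prob_space)
  \<comment> \<open>The gap between the two sides is 2 (1 - cos a)^2.\<close>
  have cos2: "1 - cos (2 * a) \<le> 4 * (1 - cos a)" for a :: real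
  proof -
    have "0 \<le> (1 - cos a)\<^sup>2" by simp
    then show ?thesis unfolding cos_double_cos power2_eq_square by (simp add: algebra_simps)
  qed
  have sin2: "\<bar>sin (2 * a) - 2 * sin a\<bar> \<le> 2 * (1 - cos a)" for a :: real
  proof -
    have "sin (2 * a) - 2 * sin a = - (2 * sin a * (1 - cos a))"
      unfolding sin_double by (simp add: algebra_simps)
    then have "\<bar>sin (2 * a) - 2 * sin a\<bar> = 2 * (\<bar>sin a\<bar> * (1 - cos a))"
      by (simp add: abs_mult)
    also have "\<dots> \<le> 2 * (1 * (1 - cos a))"
      by (intro mult_left_mono mult_right_mono) auto
    finally show ?thesis by simp
  qed
  have "(LINT \<omega>|M. 1 - cos ((2 *\<^sub>R \<xi>) \<bullet> X t \<omega>)) \<le> (LINT \<omega>|M. 4 * (1 - cos (\<xi> \<bullet> X t \<omega>)))"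
  proof (rule integral_mono)
    show "1 - cos ((2 *\<^sub>R \<xi>) \<bullet> X t \<omega>) \<le> 4 * (1 - cos (\<xi> \<bullet> X t \<omega>))" for \<omega>
      using cos2[of "\<xi> \<bullet> X t \<omega>"] by simp
  qed (intro integrable_mult_right Bochner_Integration.integrable_diff integrable_const int)+
  then show "1 - Re (char_fun t (2 *\<^sub>R \<xi>)) \<le> 4 * (1 - Re (char_fun t \<xi>))"
    by (simp only: one integral_mult_right_zero)
  have "\<bar>Im (char_fun t (2 *\<^sub>R \<xi>)) - 2 * Im (char_fun t \<xi>)\<bar>
      = \<bar>LINT \<omega>|M. sin ((2 *\<^sub>R \<xi>) \<bullet> X t \<omega>) - 2 * sin (\<xi> \<bullet> X t \<omega>)\<bar>"
    by (subst Bochner_Integration.integral_diff[OF int(2) integrable_mult_right[OF int(2)]])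
      (simp only: im integral_mult_right_zero)
  also have "\<dots> \<le> (LINT \<omega>|M. \<bar>sin ((2 *\<^sub>R \<xi>) \<bullet> X t \<omega>) - 2 * sin (\<xi> \<bullet> X t \<omega>)\<bar>)"
    by (rule integral_abs_bound)
  also have "\<dots> \<le> (LINT \<omega>|M. 2 * (1 - cos (\<xi> \<bullet> X t \<omega>)))"
  proof (rule integral_mono)
    show "\<bar>sin ((2 *\<^sub>R \<xi>) \<bullet> X t \<omega>) - 2 * sin (\<xi> \<bullet> X t \<omega>)\<bar> \<le> 2 * (1 - cos (\<xi> \<bullet> X t \<omega>))" for \<omega>
      using sin2[of "\<xi> \<bullet> X t \<omega>"] by simp
  qed (intro integrable_abs integrable_mult_right Bochner_Integration.integrable_diff integrable_const int)+
  also have "\<dots> = 2 * (1 - Re (char_fun t \<xi>))"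
    by (simp only: one integral_mult_right_zero)
  finally show "\<bar>Im (char_fun t (2 *\<^sub>R \<xi>)) - 2 * Im (char_fun t \<xi>)\<bar> \<le> 2 * (1 - Re (char_fun t \<xi>))" .
qed

text \<open>Iterated from the unit ball, this gives polynomial growth of the exponent.\<close>
lemma exponent_double:
  assumes "levy_exponent M X \<Psi>"
  shows "\<bar>Re (\<Psi> (2 *\<^sub>R \<xi>) $ j)\<bar> + \<bar>Im (\<Psi> (2 *\<^sub>R \<xi>) $ j)\<bar> \<le> 8 * (\<bar>Re (\<Psi> \<xi> $ j)\<bar> + \<bar>Im (\<Psi> \<xi> $ j)\<bar>)"
proof -
  let ?r = "\<lambda>n. inverse (real (Suc n))"
  let ?\<phi> = "\<lambda>n. char_fun (?r n *\<^sub>R axis j 1)"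
  have re: "(\<lambda>n. (Re (?\<phi> n \<xi>) - 1) / ?r n) \<longlonglongrightarrow> Re (\<Psi> \<xi> $ j)"
    and im: "(\<lambda>n. Im (?\<phi> n \<xi>) / ?r n) \<longlonglongrightarrow> Im (\<Psi> \<xi> $ j)" for \<xi>
    using tendsto_Re[OF exponent_quotient[OF assms, of j \<xi>]] tendsto_Im[OF exponent_quotient[OF assms, of j \<xi>]]
    by (simp_all add: divide_inverse mult.commute del: of_nat_Suc)
  have "- Re (\<Psi> (2 *\<^sub>R \<xi>) $ j) \<le> 4 * - Re (\<Psi> \<xi> $ j)"
  proof (rule LIMSEQ_le)
    show "(\<lambda>n. - ((Re (?\<phi> n (2 *\<^sub>R \<xi>)) - 1) / ?r n)) \<longlonglongrightarrow> - Re (\<Psi> (2 *\<^sub>R \<xi>) $ j)"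
      by (intro tendsto_minus re)
    show "(\<lambda>n. 4 * - ((Re (?\<phi> n \<xi>) - 1) / ?r n)) \<longlonglongrightarrow> 4 * - Re (\<Psi> \<xi> $ j)"
      by (intro tendsto_mult tendsto_const tendsto_minus re)
    have "- ((Re (?\<phi> n (2 *\<^sub>R \<xi>)) - 1) / ?r n) \<le> 4 * - ((Re (?\<phi> n \<xi>) - 1) / ?r n)" for n
      using divide_right_mono[OF one_minus_Re_char_fun_double(1)[OF axis_nonneg, of "?r n" j \<xi>], of "?r n"]
      by (simp add: minus_divide_left del: of_nat_Suc)
    then show "\<exists>N. \<forall>n\<ge>N. - ((Re (?\<phi> n (2 *\<^sub>R \<xi>)) - 1) / ?r n) \<le> 4 * - ((Re (?\<phi> n \<xi>) - 1) / ?r n)"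
      by blast
  qed
  moreover have "\<bar>Im (\<Psi> (2 *\<^sub>R \<xi>) $ j) - 2 * Im (\<Psi> \<xi> $ j)\<bar> \<le> 2 * - Re (\<Psi> \<xi> $ j)"
  proof (rule LIMSEQ_le)
    show "(\<lambda>n. \<bar>Im (?\<phi> n (2 *\<^sub>R \<xi>)) / ?r n - 2 * (Im (?\<phi> n \<xi>) / ?r n)\<bar>)
        \<longlonglongrightarrow> \<bar>Im (\<Psi> (2 *\<^sub>R \<xi>) $ j) - 2 * Im (\<Psi> \<xi> $ j)\<bar>"
      by (intro tendsto_rabs tendsto_diff tendsto_mult tendsto_const im)
    show "(\<lambda>n. 2 * - ((Re (?\<phi> n \<xi>) - 1) / ?r n)) \<longlonglongrightarrow> 2 * - Re (\<Psi> \<xi> $ j)"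
      by (intro tendsto_mult tendsto_const tendsto_minus re)
    have "\<bar>Im (?\<phi> n (2 *\<^sub>R \<xi>)) / ?r n - 2 * (Im (?\<phi> n \<xi>) / ?r n)\<bar> \<le> 2 * - ((Re (?\<phi> n \<xi>) - 1) / ?r n)" for n
    proof -
      have "\<bar>a / ?r n - 2 * (b / ?r n)\<bar> = \<bar>a - 2 * b\<bar> / ?r n" for a b
      proof -
        have "a / ?r n - 2 * (b / ?r n) = (a - 2 * b) / ?r n"
          by (simp only: diff_divide_distrib times_divide_eq_right)
        then show ?thesis by (simp only: abs_divide) simp
      qed
      then have "\<bar>Im (?\<phi> n (2 *\<^sub>R \<xi>)) / ?r n - 2 * (Im (?\<phi> n \<xi>) / ?r n)\<bar>
          = \<bar>Im (?\<phi> n (2 *\<^sub>R \<xi>)) - 2 * Im (?\<phi> n \<xi>)\<bar> / ?r n" .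
      also have "\<dots> \<le> (2 * (1 - Re (?\<phi> n \<xi>))) / ?r n"
        by (intro divide_right_mono one_minus_Re_char_fun_double(2) axis_nonneg) auto
      also have "\<dots> = 2 * - ((Re (?\<phi> n \<xi>) - 1) / ?r n)"
        by (simp add: minus_divide_left del: of_nat_Suc)
      finally show ?thesis .
    qed
    then show "\<exists>N. \<forall>n\<ge>N. \<bar>Im (?\<phi> n (2 *\<^sub>R \<xi>)) / ?r n - 2 * (Im (?\<phi> n \<xi>) / ?r n)\<bar>
        \<le> 2 * - ((Re (?\<phi> n \<xi>) - 1) / ?r n)" by blast
  qed
  \<comment> \<open>With A = |Re| and B = |Im| at \<xi>, the new real part is at most 4 A and the
    new imaginary part at most 2 B + 2 A; the sum 6 A + 2 B is below 8 (A + B).\<close>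
  ultimately show ?thesis
    using Re_exponent_le_0[OF assms, of \<xi> j] Re_exponent_le_0[OF assms, of "2 *\<^sub>R \<xi>" j]
    by (smt (verit))
qed

text \<open>On the event that the displacement exceeds 1/4 the integrand is at most 2, elsewhere at
  most 1/4 because |\<xi>| \<le> 1. Continuity in probability makes that event rarer than 1/8, so
  the total is at most 1/4 + 2/8.\<close>

lemma char_fun_near_1:
  obtains t0 where "0 < t0" "\<And>t \<xi>. 0 \<le> t \<Longrightarrow> t \<le> t0 \<Longrightarrow> norm \<xi> \<le> 1 \<Longrightarrow>
    norm (char_fun (t *\<^sub>R axis j 1) \<xi> - 1) \<le> 1 / 2"
proof -
  let ?P = "\<lambda>s. prob {\<omega> \<in> space M. 1 / 4 < norm (X s \<omega> - X 0 \<omega>)}"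
  have "(?P \<longlongrightarrow> 0) (at 0 within {0..})"
    by (rule continuous_in_probability) auto
  then have "\<forall>\<^sub>F s in at 0 within {0..}. ?P s < 1 / 8"
    by (rule order_tendstoD) simp
  then obtain d where d: "0 < d" "\<And>s. 0 \<le> s \<Longrightarrow> s \<noteq> 0 \<Longrightarrow> dist s 0 < d \<Longrightarrow> ?P s < 1 / 8"
    unfolding eventually_at by auto
  have "norm (char_fun (t *\<^sub>R axis j 1) \<xi> - 1) \<le> 1 / 2"
    if t: "0 \<le> t" "t \<le> d / 2" and \<xi>: "norm \<xi> \<le> 1" for t \<xi>
  proof -
    define s :: "real^'n" where "s = t *\<^sub>R axis j 1"
    have s: "0 \<le> s" unfolding s_def using t(1) by (rule axis_nonneg)
    note [measurable] = random_variable_X[OF s] random_variable_X[OF order_refl]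
    define A where "A = {\<omega> \<in> space M. 1 / 4 < norm (X s \<omega> - X 0 \<omega>)}"
    have [measurable]: "A \<in> sets M" unfolding A_def by measurable
    have "prob A < 1 / 8"
    \<comment> \<open>The punctured limit says nothing at time 0 itself, where the displacement
      vanishes identically.\<close>
    proof (cases "s = 0")
      case True
      then show ?thesis by (simp add: A_def)
    next
      case False
      have "dist s 0 < d" using t d(1) by (simp add: s_def)
      with d(2)[OF s False] show ?thesis by (simp add: A_def)
    qed
    have "char_fun s \<xi> - 1 = (LINT \<omega>|M. iexp (\<xi> \<bullet> X s \<omega>) - 1)"
      unfolding char_fun_def using integrable_iexp_X[OF s, of \<xi>] by (simp add: prob_space)
    also have "norm \<dots> \<le> (LINT \<omega>|M. norm (iexp (\<xi> \<bullet> X s \<omega>) - 1))"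
      by (rule integral_norm_bound)
    also have "\<dots> \<le> (LINT \<omega>|M. 1 / 4 + 2 * indicator A \<omega>)"
    proof (rule integral_mono_AE)
      show "integrable M (\<lambda>\<omega>. norm (iexp (\<xi> \<bullet> X s \<omega>) - 1))"
        using integrable_iexp_X[OF s, of \<xi>] by simp
      show "integrable M (\<lambda>\<omega>. 1 / 4 + 2 * indicator A \<omega> :: real)"
        by (intro Bochner_Integration.integrable_add integrable_mult_right) (auto simp: emeasure_eq_measure)
      show "AE \<omega> in M. norm (iexp (\<xi> \<bullet> X s \<omega>) - 1) \<le> 1 / 4 + 2 * indicator A \<omega>"
        using starts_at_0 AE_space
      proof eventually_elim
        fix \<omega> assume w: "X 0 \<omega> = 0" "\<omega> \<in> space M"
        show "norm (iexp (\<xi> \<bullet> X s \<omega>) - 1) \<le> 1 / 4 + 2 * indicator A \<omega>"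
        proof (cases "\<omega> \<in> A")
          case True
          have "norm (iexp (\<xi> \<bullet> X s \<omega>) - 1) \<le> norm (iexp (\<xi> \<bullet> X s \<omega>)) + norm (1::complex)"
            by (rule norm_triangle_ineq4)
          then show ?thesis using True by simp
        next
          case False
          then have "norm (X s \<omega>) \<le> 1 / 4" using w by (auto simp: A_def)
          have "norm (iexp (\<xi> \<bullet> X s \<omega>) - 1) \<le> \<bar>\<xi> \<bullet> X s \<omega>\<bar>"
            using iexp_approx1[of "\<xi> \<bullet> X s \<omega>" 0] by simp
          also have "\<dots> \<le> norm \<xi> * norm (X s \<omega>)" by (rule Cauchy_Schwarz_ineq2)
          also have "\<dots> \<le> 1 * (1 / 4)"
            using \<xi> \<open>norm (X s \<omega>) \<le> 1 / 4\<close> by (intro mult_mono) auto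
          finally show ?thesis using False by simp
        qed
      qed
    qed
    also have "\<dots> = 1 / 4 + 2 * prob A"
      by (subst Bochner_Integration.integral_add) (auto simp: prob_space emeasure_eq_measure)
    also have "\<dots> \<le> 1 / 2" using \<open>prob A < 1 / 8\<close> by simp
    finally show ?thesis by (simp add: s_def)
  qed
  then show ?thesis using that[of "d / 2"] d(1) by auto
qed

text \<open>Each doubling costs a factor 8 and 8^n = (2^n)^3, so the bound on the unit ball
  propagates to cubic growth.\<close>

lemma exponent_growth:
  assumes \<Psi>: "levy_exponent M X \<Psi>"
  obtains C where "0 \<le> C" "\<And>\<xi>. norm (\<Psi> \<xi> $ j) \<le> C * (1 + (norm \<xi>)\<^sup>2) ^ 2"
proof -
  let ?N = "\<lambda>\<xi>. \<bar>Re (\<Psi> \<xi> $ j)\<bar> + \<bar>Im (\<Psi> \<xi> $ j)\<bar>"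
  obtain t0 where t0: "0 < t0" "\<And>t \<xi>. 0 \<le> t \<Longrightarrow> t \<le> t0 \<Longrightarrow> norm \<xi> \<le> 1 \<Longrightarrow>
      norm (char_fun (t *\<^sub>R axis j 1) \<xi> - 1) \<le> 1 / 2"
    using char_fun_near_1 by blast
  define C where "C = ln 2 / t0 + pi / (2 * t0)"
  have "0 \<le> C" using t0(1) by (simp add: C_def)
  have base: "?N \<xi> \<le> C" if "norm \<xi> \<le> 1" for \<xi>
  proof -
    have "norm (exp (of_real t * \<Psi> \<xi> $ j) - 1) \<le> 1 / 2" if "0 \<le> t" "t \<le> t0" for t
      using t0(2)[OF that \<open>norm \<xi> \<le> 1\<close>] char_fun_axis[OF \<Psi> that(1)] by simp
    from exponent_bound_of_exp_near_1[OF t0(1) this] Re_exponent_le_0[OF \<Psi>, of \<xi> j]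
    show ?thesis by (auto simp: C_def)
  qed
  have dyadic: "?N \<xi> \<le> 8 ^ n * C" if "norm \<xi> \<le> 2 ^ n" for n \<xi>
    using that
  proof (induction n arbitrary: \<xi>)
    case 0
    then show ?case using base by simp
  next
    case (Suc n)
    have "?N (2 *\<^sub>R (\<xi> /\<^sub>R 2)) \<le> 8 * ?N (\<xi> /\<^sub>R 2)" by (rule exponent_double[OF \<Psi>])
    also have "\<dots> \<le> 8 * (8 ^ n * C)" using Suc by (intro mult_left_mono Suc.IH) auto
    finally show ?case by simp
  qed
  have "norm (\<Psi> \<xi> $ j) \<le> 64 * C * (1 + (norm \<xi>)\<^sup>2) ^ 2" for \<xi>
  proof -
    have "norm (\<Psi> \<xi> $ j) \<le> ?N \<xi>" by (rule cmod_le)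
    also have "?N \<xi> \<le> 64 * C * (1 + (norm \<xi>)\<^sup>2) ^ 2"
    proof (cases "norm \<xi> \<le> 1")
      case True
      have "1 \<le> (1 + (norm \<xi>)\<^sup>2) ^ 2" by (rule one_le_power) simp
      then have "1 \<le> 64 * (1 + (norm \<xi>)\<^sup>2) ^ 2" by linarith
      then have "C * 1 \<le> C * (64 * (1 + (norm \<xi>)\<^sup>2) ^ 2)"
        using \<open>0 \<le> C\<close> by (rule mult_left_mono)
      with base[OF True] show ?thesis by (simp add: mult_ac)
    next
      case False
      \<comment> \<open>The least number of doublings that reaches \<xi>: rounding up overshoots by
        at most a factor 2, so 2^n lies between |\<xi>| and 2 |\<xi>|.\<close>
      define n where "n = nat \<lceil>log 2 (norm \<xi>)\<rceil>"
      have "0 < norm \<xi>" using False by linarith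
      then have pos: "0 < log 2 (norm \<xi>)" using False by (subst zero_less_log_cancel_iff) auto
      then have n: "log 2 (norm \<xi>) \<le> n" "n \<le> log 2 (norm \<xi>) + 1"
        unfolding n_def by linarith+
      have "norm \<xi> = 2 powr log 2 (norm \<xi>)" using \<open>0 < norm \<xi>\<close> by simp
      also have "\<dots> \<le> 2 powr n" using n(1) by simp
      finally have up: "norm \<xi> \<le> 2 ^ n" by (simp add: powr_realpow)
      have "2 powr n \<le> 2 powr (log 2 (norm \<xi>) + 1)" using n(2) by simp
      also have "\<dots> = 2 * norm \<xi>" using \<open>0 < norm \<xi>\<close> by (simp add: powr_add)
      finally have lo: "2 ^ n \<le> 2 * norm \<xi>" by (simp add: powr_realpow)
      have "(8::real) ^ n = (2 ^ 3) ^ n" by simp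
      also have "\<dots> = (2 ^ n) ^ 3" by (simp only: power_mult[symmetric] mult.commute)
      also have "\<dots> \<le> (2 * norm \<xi>) ^ 3" using lo by (intro power_mono) auto
      \<comment> \<open>The cube is raised to a fourth power, using |\<xi>| > 1, to fit under the
        square of 1 + |\<xi>|^2.\<close>
      also have "\<dots> \<le> 8 * (norm \<xi>) ^ 4"
        using False by (simp add: power_mult_distrib power_increasing)
      also have "\<dots> \<le> 64 * (1 + (norm \<xi>)\<^sup>2) ^ 2"
      proof -
        have "((norm \<xi>)\<^sup>2) ^ 2 \<le> (1 + (norm \<xi>)\<^sup>2) ^ 2" by (intro power_mono) auto
        then have "(norm \<xi>) ^ 4 \<le> (1 + (norm \<xi>)\<^sup>2) ^ 2" by (simp flip: power_mult)
        moreover have "0 \<le> (1 + (norm \<xi>)\<^sup>2) ^ 2" by simp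
        ultimately show ?thesis by linarith
      qed
      finally have "8 ^ n * C \<le> 64 * (1 + (norm \<xi>)\<^sup>2) ^ 2 * C"
        using \<open>0 \<le> C\<close> by (rule mult_right_mono)
      with dyadic[OF up] show ?thesis by (simp add: mult_ac)
    qed
    finally show ?thesis .
  qed
  then show ?thesis using that[of "64 * C"] \<open>0 \<le> C\<close> by simp
qed

end

subsection \<open>The semigroup and its generator\<close>

lemma C0_diff_scaleR:
  assumes "u \<in> C0" "v \<in> C0"
  shows "(\<lambda>x. a *\<^sub>R (u x - v x)) \<in> C0"
proof -
  have "((\<lambda>x. a *\<^sub>R (u x - v x)) \<longlongrightarrow> a *\<^sub>R (0 - 0)) at_infinity"
    using assms unfolding C0_def by (intro tendsto_intros) auto
  moreover have "continuous_on UNIV (\<lambda>x. a *\<^sub>R (u x - v x))"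
    using assms unfolding C0_def by (intro continuous_intros) auto
  ultimately show ?thesis by (simp add: C0_def)
qed

text \<open>Closedness of \<open>C0\<close> in the sup-norm. It places the value of the generator in
  \<open>C0\<close> without a separate study of its Fourier integral at infinity.\<close>

lemma C0_of_uniform_limit:
  assumes u: "\<And>n. u n \<in> C0" and lim: "uniform_limit UNIV u v sequentially"
  shows "v \<in> C0"
proof -
  have "continuous_on UNIV v"
    by (rule uniform_limit_theorem[OF _ lim]) (use u in \<open>auto simp: C0_def\<close>)
  moreover have "(v \<longlongrightarrow> 0) at_infinity"
  proof (rule tendstoI)
    fix e :: real assume "0 < e"
    then obtain n where n: "\<And>x. dist (u n x) (v x) < e / 2"
      using uniform_limitD[OF lim, of "e / 2"] by (auto simp: eventually_sequentially)
    have "(u n \<longlongrightarrow> 0) at_infinity" using u by (simp add: C0_def)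
    then have "\<forall>\<^sub>F x in at_infinity. dist (u n x) 0 < e / 2"
      using \<open>0 < e\<close> by (intro tendstoD) auto
    then show "\<forall>\<^sub>F x in at_infinity. dist (v x) 0 < e"
      by eventually_elim (metis n dist_commute dist_triangle_half_r)
  qed
  ultimately show ?thesis by (simp add: C0_def)
qed

text \<open>Mean value inequality on the convex left half-plane, where the derivative of the
  exponential has modulus at most 1.\<close>

lemma norm_exp_minus_1_le:
  fixes z :: complex
  assumes "Re z \<le> 0"
  shows "norm (exp z - 1) \<le> norm z"
proof -
  have "norm (exp z - exp 0) \<le> 1 * norm (z - 0)"
  proof (rule field_differentiable_bound[where S="{w. Re w \<le> 0}" and f'=exp])
    show "convex {w. Re w \<le> 0}" by (rule convex_halfspace_Re_le)
  qed (use assms in \<open>auto intro!: derivative_eq_intros\<close>)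
  then show ?thesis by simp
qed

context multiparameter_levy_process
begin

text \<open>Functions in \<open>C0\<close> are bounded, so dominated convergence applies along any
  sequence of points; \<open>dct\<close> serves both continuity and decay.\<close>

lemma levy_semigroup_C0:
  assumes u: "u \<in> C0" and t: "0 \<le> t"
  shows "levy_semigroup M X t u \<in> C0"
proof -
  note [measurable] = random_variable_X[OF t]
  have cont: "continuous_on UNIV u" and lim: "(u \<longlongrightarrow> 0) at_infinity"
    using u by (auto simp: C0_def)
  have [measurable]: "u \<in> borel_measurable borel"
    using cont by (rule borel_measurable_continuous_onI)
  obtain R where R: "\<And>x. R \<le> norm x \<Longrightarrow> norm (u x) < 1"
    using tendstoD[OF lim, of 1] by (auto simp: eventually_at_infinity)
  have "bounded (u ` cball 0 R)"
    by (intro compact_imp_bounded compact_continuous_image continuous_on_subset[OF cont]) auto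
  then obtain K where "\<And>x. x \<in> cball 0 R \<Longrightarrow> norm (u x) \<le> K"
    unfolding bounded_iff by blast
  then have K: "norm (u x) \<le> K" if "norm x \<le> R" for x
    using that by simp
  define B where "B = max 1 K"
  have B: "norm (u x) \<le> B" for x
    using R[of x] K[of x] by (cases "norm x \<le> R") (auto simp: B_def)
  have dct: "(\<lambda>n. levy_semigroup M X t u (y n)) \<longlonglongrightarrow> (LINT \<omega>|M. f \<omega>)"
    if [measurable]: "f \<in> borel_measurable M" and "\<And>\<omega>. (\<lambda>n. u (y n + X t \<omega>)) \<longlonglongrightarrow> f \<omega>" for y f
    unfolding levy_semigroup_def
    by (rule integral_dominated_convergence[where w="\<lambda>_. B"]) (use that B in auto)
  have "continuous_on UNIV (levy_semigroup M X t u)"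
    unfolding continuous_on_sequentially comp_def
  proof (intro allI ballI impI)
    fix y and x :: "real^'d" assume "(\<forall>n. y n \<in> UNIV) \<and> y \<longlonglongrightarrow> x"
    then have "(\<lambda>n. u (y n + X t \<omega>)) \<longlonglongrightarrow> u (x + X t \<omega>)" for \<omega>
      using cont by (intro isCont_tendsto_compose[of _ u] tendsto_add tendsto_const)
        (auto simp: continuous_on_eq_continuous_at)
    from dct[OF _ this] show "(\<lambda>n. levy_semigroup M X t u (y n)) \<longlonglongrightarrow> levy_semigroup M X t u x"
      by (simp add: levy_semigroup_def)
  qed
  moreover have "(levy_semigroup M X t u \<longlongrightarrow> 0) at_infinity"
  \<comment> \<open>If decay failed, points \<open>y n\<close> with norm at least \<open>n\<close>
    would keep the value at least \<open>e\<close>; but each translate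
    \<open>y n + X t \<omega>\<close> escapes to infinity.\<close>
  proof (rule tendstoI, rule ccontr)
    fix e :: real
    assume "0 < e" and "\<not> (\<forall>\<^sub>F x in at_infinity. dist (levy_semigroup M X t u x) 0 < e)"
    then have "\<exists>x. real n \<le> norm x \<and> e \<le> norm (levy_semigroup M X t u x)" for n :: nat
      by (auto simp: eventually_at_infinity not_less)
    then obtain y where y: "\<And>n. real n \<le> norm (y n)" "\<And>n. e \<le> norm (levy_semigroup M X t u (y n))"
      by metis
    have "filterlim (\<lambda>n. norm (y n)) at_top sequentially"
      by (rule filterlim_at_top_mono[OF filterlim_real_sequentially]) (use y in auto)
    then have "filterlim y at_infinity sequentially"
      by (rule filterlim_norm_at_top_imp_at_infinity)
    then have "filterlim (\<lambda>n. y n + X t \<omega>) at_infinity sequentially" for \<omega>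
      by (rule tendsto_add_filterlim_at_infinity'[OF _ tendsto_const])
    from dct[OF _ filterlim_compose[OF lim this]]
    have "(\<lambda>n. levy_semigroup M X t u (y n)) \<longlonglongrightarrow> 0" by simp
    from tendstoD[OF this \<open>0 < e\<close>] y(2) show False
      by (auto simp: eventually_sequentially not_less[symmetric])
  qed
  ultimately show ?thesis by (simp add: C0_def)
qed

text \<open>Stated with \<open>char_fun\<close> as symbol, so that it serves general times through
  \<open>char_fun_exponent\<close> and axis times through \<open>char_fun_axis\<close>.\<close>

lemma levy_semigroup_fourier:
  assumes h: "h \<in> schwartz" and t: "0 \<le> t"
  shows "integrable lborel (\<lambda>\<xi>. iexp (\<xi> \<bullet> x) * char_fun t \<xi> * fourier h \<xi>)"
    and "levy_semigroup M X t h x = of_real ((2 * pi) powr (- real CARD('d) / 2)) *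
      (LINT \<xi>|lborel. iexp (\<xi> \<bullet> x) * char_fun t \<xi> * fourier h \<xi>)"
proof -
  note [measurable] = random_variable_X[OF t] char_fun_measurable[OF t]
    fourier_measurable[OF schwartz_measurable[OF h]]
  note fh = fourier_schwartz_integrable[OF h]
  show "integrable lborel (\<lambda>\<xi>. iexp (\<xi> \<bullet> x) * char_fun t \<xi> * fourier h \<xi>)"
    by (rule Bochner_Integration.integrable_bound[OF fh])
      (auto simp: norm_mult intro!: mult_left_le_one_le norm_char_fun_le)
  interpret P: pair_sigma_finite M "lborel :: (real^'d) measure" ..
  \<comment> \<open>The modulus of the integrand is that of the transform, whatever \<omega> is, and
    \<open>M\<close> has total mass 1.\<close>
  have int: "integrable (M \<Otimes>\<^sub>M lborel) (\<lambda>(\<omega>, \<xi>). iexp (\<xi> \<bullet> (x + X t \<omega>)) * fourier h \<xi>)"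
  proof (rule P.Fubini_integrable)
    have "integrable lborel (\<lambda>\<xi>. iexp (\<xi> \<bullet> z) * fourier h \<xi>)" for z
      by (rule Bochner_Integration.integrable_bound[OF fh]) (auto simp: norm_mult)
    then show "AE \<omega> in M. integrable lborel (\<lambda>\<xi>. case (\<omega>, \<xi>) of (\<omega>, \<xi>) \<Rightarrow> iexp (\<xi> \<bullet> (x + X t \<omega>)) * fourier h \<xi>)"
      by simp
  qed (auto simp: norm_mult)
  have "levy_semigroup M X t h x = of_real ((2 * pi) powr (- real CARD('d) / 2)) *
      (LINT \<omega>|M. (LINT \<xi>|lborel. iexp (\<xi> \<bullet> (x + X t \<omega>)) * fourier h \<xi>))"
    unfolding levy_semigroup_def by (subst schwartz_fourier_inversion[OF h]) simp
  also have "(LINT \<omega>|M. (LINT \<xi>|lborel. iexp (\<xi> \<bullet> (x + X t \<omega>)) * fourier h \<xi>))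
      = (LINT \<xi>|lborel. (LINT \<omega>|M. iexp (\<xi> \<bullet> (x + X t \<omega>)) * fourier h \<xi>))"
    by (rule P.Fubini_integral[symmetric]) (rule int)
  also have "\<dots> = (LINT \<xi>|lborel. iexp (\<xi> \<bullet> x) * char_fun t \<xi> * fourier h \<xi>)"
  proof (rule Bochner_Integration.integral_cong)
    fix \<xi>
    have "iexp (\<xi> \<bullet> (x + X t \<omega>)) = iexp (\<xi> \<bullet> x) * iexp (\<xi> \<bullet> X t \<omega>)" for \<omega>
      by (simp add: inner_add_right distrib_left exp_add)
    then show "(LINT \<omega>|M. iexp (\<xi> \<bullet> (x + X t \<omega>)) * fourier h \<xi>) = iexp (\<xi> \<bullet> x) * char_fun t \<xi> * fourier h \<xi>"
      by (simp add: char_fun_def)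
  qed simp
  finally show "levy_semigroup M X t h x = of_real ((2 * pi) powr (- real CARD('d) / 2)) *
      (LINT \<xi>|lborel. iexp (\<xi> \<bullet> x) * char_fun t \<xi> * fourier h \<xi>)" .
qed

lemma exponent_fourier_integrable:
  assumes \<Psi>: "levy_exponent M X \<Psi>" and h: "h \<in> schwartz"
  shows "integrable lborel (\<lambda>\<xi>. \<Psi> \<xi> $ j * fourier h \<xi>)"
proof -
  note [measurable] = exponent_measurable[OF \<Psi>] fourier_measurable[OF schwartz_measurable[OF h]]
  obtain C where C: "0 \<le> C" "\<And>\<xi>. norm (\<Psi> \<xi> $ j) \<le> C * (1 + (norm \<xi>)\<^sup>2) ^ 2"
    using exponent_growth[OF \<Psi>] by blast
  \<comment> \<open>Two of the three weight powers absorb the growth of the exponent; the third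
    remains for \<open>integrable_of_weight_bound\<close>.\<close>
  obtain D where D: "\<And>\<xi>. norm (fourier h \<xi>) * vec_weight \<xi> ^ 3 \<le> D"
    using fourier_schwartz_decay[OF h] by blast
  show ?thesis
  proof (rule integrable_of_weight_bound)
    fix \<xi> :: "real^'d"
    have "norm (\<Psi> \<xi> $ j) \<le> C * (1 + (norm \<xi>)\<^sup>2) ^ 2" by (rule C(2))
    also have "\<dots> \<le> C * vec_weight \<xi> ^ 2"
      by (intro mult_left_mono power_mono one_plus_norm_le_vec_weight C) auto
    finally have "norm (\<Psi> \<xi> $ j * fourier h \<xi>) * vec_weight \<xi>
        \<le> (C * vec_weight \<xi> ^ 2) * norm (fourier h \<xi>) * vec_weight \<xi>"
      unfolding norm_mult using vec_weight_pos[of \<xi>] by (intro mult_right_mono) auto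
    also have "\<dots> = C * (norm (fourier h \<xi>) * vec_weight \<xi> ^ 3)"
      by (simp add: power2_eq_square power3_eq_cube mult_ac)
    also have "\<dots> \<le> C * D" by (intro mult_left_mono D C)
    finally show "norm (\<Psi> \<xi> $ j * fourier h \<xi>) * vec_weight \<xi> \<le> C * D" .
  qed measurable
qed

text \<open>The point \<open>x\<close> enters both the difference quotient and its limit only
  through a phase of modulus 1, so one integral free of \<open>x\<close> bounds their distance
  uniformly.\<close>

lemma has_generator_schwartz:
  assumes \<Psi>: "levy_exponent M X \<Psi>" and h: "h \<in> schwartz"
  shows "has_generator (marginal_semigroup (levy_semigroup M X) j) h
    (\<lambda>x. of_real ((2 * pi) powr (- real CARD('d) / 2)) *
      (LINT \<xi>|lborel. iexp (\<xi> \<bullet> x) * \<Psi> \<xi> $ j * fourier h \<xi>))" (is "has_generator ?S h ?v")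
proof -
  let ?c = "(2 * pi) powr (- real CARD('d) / 2)"
  note [measurable] = fourier_measurable[OF schwartz_measurable[OF h]]
  note fh = fourier_schwartz_integrable[OF h]
  note [measurable] = exponent_measurable[OF \<Psi>, of j]
  note \<psi>h = exponent_fourier_integrable[OF \<Psi> h, of j]
  define q where "q r \<xi> = (exp (of_real r * \<Psi> \<xi> $ j) - 1) /\<^sub>R r" for r \<xi>
  \<comment> \<open>The uniform error bound: the L1 distance between the symbols of quotient and
    limit, weighted by the transform.\<close>
  define \<delta> where "\<delta> r = ?c * (LINT \<xi>|lborel. norm ((q r \<xi> - \<Psi> \<xi> $ j) * fourier h \<xi>))" for r
  have [measurable]: "q r \<in> borel_measurable borel" for r
    unfolding q_def by measurable
  have norm_q: "norm (q r \<xi>) \<le> norm (\<Psi> \<xi> $ j)" if "0 < r" for r \<xi>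
  proof -
    have "norm (exp (of_real r * \<Psi> \<xi> $ j) - 1) \<le> norm (of_real r * \<Psi> \<xi> $ j)"
      using Re_exponent_le_0[OF \<Psi>, of \<xi> j] that
      by (intro norm_exp_minus_1_le) (simp add: mult_nonneg_nonpos)
    moreover have "norm (q r \<xi>) = norm (exp (of_real r * \<Psi> \<xi> $ j) - 1) / r"
      using that by (simp add: q_def divide_inverse mult.commute)
    ultimately show ?thesis using that by (simp add: norm_mult pos_divide_le_eq mult.commute)
  qed
  have int_q: "integrable lborel (\<lambda>\<xi>. q r \<xi> * fourier h \<xi>)" if "0 < r" for r
    by (rule Bochner_Integration.integrable_bound[OF \<psi>h])
      (use norm_q[OF that] in \<open>auto simp: norm_mult intro!: mult_right_mono\<close>)
  have int_iexp: "integrable lborel (\<lambda>\<xi>. iexp (\<xi> \<bullet> x) * g \<xi> * fourier h \<xi>)"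
    if "integrable lborel (\<lambda>\<xi>. g \<xi> * fourier h \<xi>)" and [measurable]: "g \<in> borel_measurable borel"
    for g :: "real^'d \<Rightarrow> complex" and x
    by (rule Bochner_Integration.integrable_bound[OF that(1)]) (auto simp: norm_mult)
  have quot: "(?S r h x - h x) /\<^sub>R r = ?c * (LINT \<xi>|lborel. iexp (\<xi> \<bullet> x) * q r \<xi> * fourier h \<xi>)"
    if "0 < r" for r x
  proof -
    have nonneg: "0 \<le> r *\<^sub>R axis j (1::real)" using that by (intro axis_nonneg) auto
    have int0: "integrable lborel (\<lambda>\<xi>. iexp (\<xi> \<bullet> x) * fourier h \<xi>)"
      using int_iexp[of "\<lambda>_. 1"] fh by simp
    note T = levy_semigroup_fourier[OF h nonneg, of x]
    have "?S r h x - h x = ?c * ((LINT \<xi>|lborel. iexp (\<xi> \<bullet> x) * char_fun (r *\<^sub>R axis j 1) \<xi> * fourier h \<xi>)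
        - (LINT \<xi>|lborel. iexp (\<xi> \<bullet> x) * fourier h \<xi>))"
      unfolding marginal_semigroup_def
      by (simp only: T(2) schwartz_fourier_inversion[OF h, of x] right_diff_distrib)
    also have "\<dots> = ?c * (LINT \<xi>|lborel. iexp (\<xi> \<bullet> x) * char_fun (r *\<^sub>R axis j 1) \<xi> * fourier h \<xi>
        - iexp (\<xi> \<bullet> x) * fourier h \<xi>)"
      by (subst Bochner_Integration.integral_diff[OF T(1) int0]) simp
    also have "(\<lambda>\<xi>. iexp (\<xi> \<bullet> x) * char_fun (r *\<^sub>R axis j 1) \<xi> * fourier h \<xi> - iexp (\<xi> \<bullet> x) * fourier h \<xi>)
        = (\<lambda>\<xi>. r *\<^sub>R (iexp (\<xi> \<bullet> x) * q r \<xi> * fourier h \<xi>))"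
    proof
      fix \<xi>
      have q: "char_fun (r *\<^sub>R axis j 1) \<xi> - 1 = r *\<^sub>R q r \<xi>"
        using that by (simp add: q_def char_fun_axis[OF \<Psi>])
      have "iexp (\<xi> \<bullet> x) * char_fun (r *\<^sub>R axis j 1) \<xi> * fourier h \<xi> - iexp (\<xi> \<bullet> x) * fourier h \<xi>
          = iexp (\<xi> \<bullet> x) * (char_fun (r *\<^sub>R axis j 1) \<xi> - 1) * fourier h \<xi>"
        by (simp add: algebra_simps)
      also have "\<dots> = r *\<^sub>R (iexp (\<xi> \<bullet> x) * q r \<xi> * fourier h \<xi>)"
        unfolding q by simp
      finally show "iexp (\<xi> \<bullet> x) * char_fun (r *\<^sub>R axis j 1) \<xi> * fourier h \<xi> - iexp (\<xi> \<bullet> x) * fourier h \<xi>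
          = r *\<^sub>R (iexp (\<xi> \<bullet> x) * q r \<xi> * fourier h \<xi>)" .
    qed
    finally show ?thesis using that by (simp add: scaleR_conv_of_real)
  qed
  have bound: "norm ((?S r h x - h x) /\<^sub>R r - ?v x) \<le> \<delta> r" if "0 < r" for r x
  proof -
    have norm_diff: "norm (iexp (\<xi> \<bullet> x) * q r \<xi> * fourier h \<xi> - iexp (\<xi> \<bullet> x) * \<Psi> \<xi> $ j * fourier h \<xi>)
        = norm ((q r \<xi> - \<Psi> \<xi> $ j) * fourier h \<xi>)" for \<xi>
    proof -
      have "iexp (\<xi> \<bullet> x) * q r \<xi> * fourier h \<xi> - iexp (\<xi> \<bullet> x) * \<Psi> \<xi> $ j * fourier h \<xi>
          = iexp (\<xi> \<bullet> x) * ((q r \<xi> - \<Psi> \<xi> $ j) * fourier h \<xi>)"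
        by (simp only: mult.assoc right_diff_distrib left_diff_distrib)
      then show ?thesis
        by (simp only: norm_mult[of "iexp (\<xi> \<bullet> x)"] norm_exp_i_times mult_1)
    qed
    have "(?S r h x - h x) /\<^sub>R r - ?v x
        = ?c * (LINT \<xi>|lborel. iexp (\<xi> \<bullet> x) * q r \<xi> * fourier h \<xi> - iexp (\<xi> \<bullet> x) * \<Psi> \<xi> $ j * fourier h \<xi>)"
      unfolding quot[OF that]
      by (subst Bochner_Integration.integral_diff[OF int_iexp[OF int_q[OF that]] int_iexp[OF \<psi>h]])
        (simp_all add: right_diff_distrib)
    then have "norm ((?S r h x - h x) /\<^sub>R r - ?v x) = norm (?c * (LINT \<xi>|lborel.
        iexp (\<xi> \<bullet> x) * q r \<xi> * fourier h \<xi> - iexp (\<xi> \<bullet> x) * \<Psi> \<xi> $ j * fourier h \<xi>))"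
      by (rule arg_cong)
    also have "\<dots> \<le> ?c * (LINT \<xi>|lborel. norm (iexp (\<xi> \<bullet> x) * q r \<xi> * fourier h \<xi> - iexp (\<xi> \<bullet> x) * \<Psi> \<xi> $ j * fourier h \<xi>))"
      unfolding norm_mult by (simp add: mult_left_mono integral_norm_bound)
    also have "\<dots> = \<delta> r"
      by (simp only: norm_diff \<delta>_def)
    finally show ?thesis .
  qed
  have "(\<delta> \<longlongrightarrow> 0) (at_right 0)"
  \<comment> \<open>Dominated convergence works along sequences, so the one-sided limit is tested on
    sequences of positive times tending to 0.\<close>
  proof (rule tendsto_at_right_sequentially[where b=1])
    fix r :: "nat \<Rightarrow> real" assume pos: "\<And>n. 0 < r n" and r: "r \<longlonglongrightarrow> 0"
    \<comment> \<open>The limit integrand is identically 0; it is kept as a difference so that it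
      matches the limit rules term by term.\<close>
    have "(\<lambda>n. LINT \<xi>|lborel. norm ((q (r n) \<xi> - \<Psi> \<xi> $ j) * fourier h \<xi>))
        \<longlonglongrightarrow> (LINT \<xi>|lborel. norm ((\<Psi> \<xi> $ j - \<Psi> \<xi> $ j) * fourier h \<xi>))"
    proof (rule integral_dominated_convergence[where w="\<lambda>\<xi>. 2 * norm (\<Psi> \<xi> $ j * fourier h \<xi>)"])
      show "integrable lborel (\<lambda>\<xi>. 2 * norm (\<Psi> \<xi> $ j * fourier h \<xi>))"
        by (intro integrable_mult_right integrable_norm \<psi>h)
      have "(\<lambda>n. q (r n) \<xi>) \<longlonglongrightarrow> \<Psi> \<xi> $ j" for \<xi>
      proof -
        have "((\<lambda>r. exp (of_real r * \<Psi> \<xi> $ j)) has_vector_derivative \<Psi> \<xi> $ j) (at 0)"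
          by (rule has_vector_derivative_real_field) (auto intro!: derivative_eq_intros)
        moreover have "filterlim r (at 0) sequentially"
          using r pos by (auto simp: filterlim_at less_imp_neq[symmetric])
        ultimately have "(\<lambda>n. (exp (of_real (0 + r n) * \<Psi> \<xi> $ j) - exp (of_real 0 * \<Psi> \<xi> $ j)) /\<^sub>R r n)
            \<longlonglongrightarrow> \<Psi> \<xi> $ j"
          by (rule filterlim_compose[OF tendsto_diff_quotient])
        then show ?thesis by (simp add: q_def)
      qed
      then show "AE \<xi> in lborel. (\<lambda>n. norm ((q (r n) \<xi> - \<Psi> \<xi> $ j) * fourier h \<xi>))
          \<longlonglongrightarrow> norm ((\<Psi> \<xi> $ j - \<Psi> \<xi> $ j) * fourier h \<xi>)"
        by (intro AE_I2 tendsto_norm tendsto_mult tendsto_diff tendsto_const)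
      have "norm (q (r n) \<xi> - \<Psi> \<xi> $ j) \<le> 2 * norm (\<Psi> \<xi> $ j)" for n \<xi>
        using norm_triangle_ineq4[of "q (r n) \<xi>" "\<Psi> \<xi> $ j"] norm_q[OF pos, of n \<xi>] by linarith
      then have "norm (q (r n) \<xi> - \<Psi> \<xi> $ j) * norm (fourier h \<xi>)
          \<le> (2 * norm (\<Psi> \<xi> $ j)) * norm (fourier h \<xi>)" for n \<xi>
        by (intro mult_right_mono) auto
      then show "AE \<xi> in lborel. norm (norm ((q (r n) \<xi> - \<Psi> \<xi> $ j) * fourier h \<xi>))
          \<le> 2 * norm (\<Psi> \<xi> $ j * fourier h \<xi>)" for n
        by (simp add: norm_mult mult.assoc)
    qed simp_all
    from tendsto_mult[OF tendsto_const[of ?c] this]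
    show "(\<lambda>n. \<delta> (r n)) \<longlonglongrightarrow> 0" by (simp add: \<delta>_def)
  qed simp
  have lim: "uniform_limit UNIV (\<lambda>r x. (?S r h x - h x) /\<^sub>R r) ?v (at_right 0)"
  proof (rule uniform_limitI)
    fix e :: real assume "0 < e"
    with \<open>(\<delta> \<longlongrightarrow> 0) (at_right 0)\<close> have "\<forall>\<^sub>F r in at_right 0. \<delta> r < e"
      by (rule order_tendstoD)
    then show "\<forall>\<^sub>F r in at_right 0. \<forall>x\<in>UNIV. dist ((?S r h x - h x) /\<^sub>R r) (?v x) < e"
      using eventually_at_right_less[of 0]
    proof eventually_elim
      case (elim r)
      then show ?case using bound[of r] by (auto simp: dist_norm intro: le_less_trans)
    qed
  qed
  \<comment> \<open>Along the times \<open>inverse (Suc n)\<close> the quotients lie in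
    \<open>C0\<close>, because the semigroup preserves it, and they converge uniformly to
    \<open>?v\<close>.\<close>
  have "?v \<in> C0"
  proof (rule C0_of_uniform_limit)
    let ?r = "\<lambda>n. inverse (real (Suc n))"
    show "uniform_limit UNIV (\<lambda>n x. (?S (?r n) h x - h x) /\<^sub>R ?r n) ?v sequentially"
      by (rule filterlim_compose[OF lim filterlim_inverse_Suc_at_right])
    fix n
    have "0 \<le> ?r n *\<^sub>R axis j (1::real)" by (intro axis_nonneg) auto
    then have "?S (?r n) h \<in> C0"
      unfolding marginal_semigroup_def by (intro levy_semigroup_C0 schwartz_C0 h)
    then show "(\<lambda>x. (?S (?r n) h x - h x) /\<^sub>R ?r n) \<in> C0"
      using schwartz_C0[OF h] by (rule C0_diff_scaleR)
  qed
  with schwartz_C0[OF h] lim show ?thesis by (simp add: has_generator_def)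
qed

end

text \<open>The inclusion in the domain is part of the conclusion because \<open>generator\<close>
  is a definite description: a formula for its value alone would not assert that Schwartz functions
  belong to the domain.\<close>

theorem theorem2p16:
  fixes M :: "'w measure"
    and X :: "real^'n \<Rightarrow> 'w \<Rightarrow> real^'d"
    and \<Psi> :: "real^'d \<Rightarrow> complex^'n"
  assumes "multiparameter_levy_process M X"
    and "levy_exponent M X \<Psi>"
  shows "(\<forall>t\<ge>0. pseudo_diff_op (levy_semigroup M X t)
              (\<lambda>\<xi>. exp (\<Sum>j\<in>UNIV. of_real (t $ j) * \<Psi> \<xi> $ j))) \<and>
         schwartz \<subseteq> multi_generator_dom (levy_semigroup M X) \<and>
         (\<forall>i. pseudo_diff_op (multi_generator (levy_semigroup M X) i) (\<lambda>\<xi>. \<Psi> \<xi> $ i))"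
proof (intro conjI allI impI)
  interpret multiparameter_levy_process M X by fact
  note \<Psi> = assms(2)
  show "pseudo_diff_op (levy_semigroup M X t) (\<lambda>\<xi>. exp (\<Sum>j\<in>UNIV. of_real (t $ j) * \<Psi> \<xi> $ j))"
    if "0 \<le> t" for t
    unfolding pseudo_diff_op_def char_fun_exponent[OF \<Psi> that, symmetric]
    using levy_semigroup_fourier[OF _ that] by blast
  show "schwartz \<subseteq> multi_generator_dom (levy_semigroup M X)"
    using has_generator_schwartz[OF \<Psi>] by (auto simp: multi_generator_dom_def generator_dom_def)
  show "pseudo_diff_op (multi_generator (levy_semigroup M X) i) (\<lambda>\<xi>. \<Psi> \<xi> $ i)" for i
    unfolding pseudo_diff_op_def
  proof (intro ballI allI conjI)
    fix h :: "real^'d \<Rightarrow> complex" and x assume h: "h \<in> schwartz"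
    note [measurable] = exponent_measurable[OF \<Psi>, of i] fourier_measurable[OF schwartz_measurable[OF h]]
    show "integrable lborel (\<lambda>\<xi>. iexp (\<xi> \<bullet> x) * \<Psi> \<xi> $ i * fourier h \<xi>)"
      by (rule Bochner_Integration.integrable_bound[OF exponent_fourier_integrable[OF \<Psi> h, of i]])
        (auto simp: norm_mult)
    note gen = has_generator_schwartz[OF \<Psi> h, of i]
    \<comment> \<open>The description picks out the Fourier integral, since it is a value of the
      generator and uniform limits are unique.\<close>
    have "generator (marginal_semigroup (levy_semigroup M X) i) h = (\<lambda>x.
        of_real ((2 * pi) powr (- real CARD('d) / 2)) * (LINT \<xi>|lborel. iexp (\<xi> \<bullet> x) * \<Psi> \<xi> $ i * fourier h \<xi>))"
      unfolding generator_def 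
    proof (rule the_equality)
      show "w = (\<lambda>x. of_real ((2 * pi) powr (- real CARD('d) / 2)) *
          (LINT \<xi>|lborel. iexp (\<xi> \<bullet> x) * \<Psi> \<xi> $ i * fourier h \<xi>))"
        if "has_generator (marginal_semigroup (levy_semigroup M X) i) h w" for w
        using that gen by (rule has_generator_unique)
    qed (rule gen)
    then show "multi_generator (levy_semigroup M X) i h x = of_real ((2 * pi) powr (- real CARD('d) / 2)) *
        (LINT \<xi>|lborel. iexp (\<xi> \<bullet> x) * \<Psi> \<xi> $ i * fourier h \<xi>)"
      by (simp add: multi_generator_def)
  qed
qed

end
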